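(* For all partitions $\lambda,\mu$, the polynomial $\widetilde\Phi^{(\beta-r+s)}_{\lambda+\boldsymbol\delta_r,\mu+\boldsymbol\delta_s}(y)$ depends only on $\beta,\lambda,\mu$ and not on $r,s$, as long as $r,s\in\mathbb N$ satisfy $r\ge\ell(\lambda)$ and $s\ge\ell(\mu)$.
   Context: A partition is a weakly decreasing sequence $\lambda=(\lambda_1,\lambda_2,\dots)$ of nonnegative integers, eventually zero; $|\lambda|=\sum\lambda_i$, $\ell(\lambda)$ is the number of nonzero parts. $\boldsymbol\delta_r=(r-1,r-2,\dots,1,0)$ and, for $r\ge\ell(\lambda)$, $\lambda+\boldsymbol\delta_r=(\lambda_1+r-1,\lambda_2+r-2,\dots,\lambda_r)$. $(z)_m=\prod_{j=0}^{m-1}(z+j)$. Monic Laguerre polynomials: $\widehat L_n^{(\beta)}(y)=\sum_{i=0}^n(-1)^{n+i}\binom ni(\beta+i+1)_{n-i}y^i$; $\psi_\pm^{(\beta)}(n,x)=e^{-x^2/2}x^{\frac12\pm\beta}\widehat L_n^{(\pm\beta)}(x^2)$. For strictly decreasing tuples $\boldsymbol m=(m_1,\dots,m_r)$, $\boldsymbol n=(n_1,\dots,n_s)$ of nonnegative integers, $\Psi^{(\beta)}_{\boldsymbol m,\boldsymbol n}(x)$ is the Wronskian in $x$ of $\psi_+^{(\beta)}(m_1,x),\dots,\psi_+^{(\beta)}(m_r,x),\psi_-^{(\beta)}(n_1,x),\dots,\psi_-^{(\beta)}(n_s,x)$; $\Delta(\boldsymbol v)=\prod_{i<j}(v_j-v_i)$;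 $\kappa^{(\beta)}_{\boldsymbol m,\boldsymbol n}=\Delta(2\boldsymbol m+\beta,2\boldsymbol n-\beta)$. $\widetilde\Phi^{(\beta)}_{\boldsymbol m,\boldsymbol n}(y)\in\mathbb Z[\beta,y]$ is the polynomial, monic in $y$, such that $\Psi^{(\beta)}_{\boldsymbol m,\boldsymbol n}(x)=\kappa^{(\beta)}_{\boldsymbol m,\boldsymbol n}e^{-\frac12(r+s)x^2}x^{\frac12(r-s)^2+\beta(r-s)}\widetilde\Phi^{(\beta)}_{\boldsymbol m,\boldsymbol n}(x^2)$ identically in $\beta,x$ (its existence and uniqueness are known). *)

theory Defs
  imports Complex_Main "HOL-Analysis.Derivative" "Jordan_Normal_Form.Determinant"
    "HOL-Computational_Algebra.Polynomial"
begin

text \<open>Partitions: weakly decreasing, eventually zero sequences indexed from 0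
  (lam 0 = lambda_1, lam 1 = lambda_2, ...).\<close>
definition is_partition :: "(nat \<Rightarrow> nat) \<Rightarrow> bool" where
  "is_partition lam \<longleftrightarrow> (\<forall>i j. i \<le> j \<longrightarrow> lam j \<le> lam i) \<and> finite {i. lam i \<noteq> 0}"

definition part_length :: "(nat \<Rightarrow> nat) \<Rightarrow> nat" where
  "part_length lam = card {i. lam i \<noteq> 0}"

definition add_delta :: "(nat \<Rightarrow> nat) \<Rightarrow> nat \<Rightarrow> nat list" where
  "add_delta lam r = map (\<lambda>i. lam i + (r - 1 - i)) [0..<r]"

definition monic_laguerre :: "nat \<Rightarrow> real \<Rightarrow> real \<Rightarrow> real" where
  "monic_laguerre n b y =
     (\<Sum>i=0..n. (-1) ^ (n + i) * real (n choose i) * pochhammer (b + real i + 1) (n - i) * y ^ i)"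

definition psi_plus :: "real \<Rightarrow> nat \<Rightarrow> real \<Rightarrow> real" where
  "psi_plus b n x = exp (- x\<^sup>2 / 2) * x powr (1/2 + b) * monic_laguerre n b (x\<^sup>2)"

definition psi_minus :: "real \<Rightarrow> nat \<Rightarrow> real \<Rightarrow> real" where
  "psi_minus b n x = exp (- x\<^sup>2 / 2) * x powr (1/2 - b) * monic_laguerre n (- b) (x\<^sup>2)"

definition wronskian :: "(real \<Rightarrow> real) list \<Rightarrow> real \<Rightarrow> real" where
  "wronskian fs x = det (mat (length fs) (length fs) (\<lambda>(i, j). (deriv ^^ i) (fs ! j) x))"

definition Psi :: "real \<Rightarrow> nat list \<Rightarrow> nat list \<Rightarrow> real \<Rightarrow> real" where
  "Psi b ms ns = wronskian (map (psi_plus b) ms @ map (psi_minus b) ns)"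

definition vandermonde :: "real list \<Rightarrow> real" where
  "vandermonde v = (\<Prod>j<length v. \<Prod>i<j. v ! j - v ! i)"

definition kappa :: "real \<Rightarrow> nat list \<Rightarrow> nat list \<Rightarrow> real" where
  "kappa b ms ns = vandermonde (map (\<lambda>m. 2 * real m + b) ms @ map (\<lambda>n. 2 * real n - b) ns)"

text \<open>Elements of Z[beta, y] are represented as int poly poly: a polynomial in y whose
  coefficients are polynomials in beta.  Evaluation at a real beta gives a real poly in y.\<close>
definition eval_beta :: "int poly poly \<Rightarrow> real \<Rightarrow> real poly" where
  "eval_beta P b = map_poly (\<lambda>c. poly (map_poly of_int c) b) P"

definition PhiT :: "nat list \<Rightarrow> nat list \<Rightarrow> int poly poly" where
  "PhiT ms ns = (THE P. lead_coeff P = 1 \<and>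
     (\<forall>b x. x > 0 \<longrightarrow>
        Psi b ms ns x =
          kappa b ms ns * exp (- (real (length ms) + real (length ns)) / 2 * x\<^sup>2)
          * x powr ((real (length ms) - real (length ns))\<^sup>2 / 2 + b * (real (length ms) - real (length ns)))
          * poly (eval_beta P b) (x\<^sup>2)))"

definition PhiT_eval :: "real \<Rightarrow> nat list \<Rightarrow> nat list \<Rightarrow> real \<Rightarrow> real" where
  "PhiT_eval b ms ns y = poly (eval_beta (PhiT ms ns) b) y"

end

theory Submission
  imports Defs "HOL-Computational_Algebra.Formal_Power_Series"
begin

text \<open>
  With \<open>y = x\<^sup>2\<close> and the common factor of the seed functions removed, the Wronskian becomes the
  determinant of the Euler derivatives of \<open>f\<^sub>a = \<Sum>k c\<^sub>k y\<^sup>a\<^sup>-\<^sup>k\<close>, where the leading exponent \<open>a\<close> is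
  \<open>m + \<beta>\<close> or \<open>n\<close>; all these series solve the same Laguerre equation, in which \<open>a\<close> is the spectral
  parameter.  The logarithmic Euler derivative of \<open>f\<^sub>a\<close> solves a Riccati equation whose formal
  solution in \<open>1/y\<close> has coefficients in \<open>\<int>[\<beta>, a]\<close>.  Hence, up to the product of the \<open>f\<^sub>a\<close>, the
  columns of the determinant are polynomial in \<open>a\<close>, and the Vandermonde product of the exponents
  divides it over \<open>\<int>[\<beta>]\<close>; this gives the existence of the monic integral polynomial.
  Enlarging \<open>r\<close> or \<open>s\<close> by one appends the degree 0 to one of the blocks, whose column is a pure power;
  a change of basis of the rows annihilates it outside the first row, and the Laplace
  expansion along it is the Crum-Darboux reduction to the smaller determinant.
\<close>

section \<open>Determinants with polynomial columns\<close>

lemma det_scale_columns: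
  fixes B :: "nat \<Rightarrow> nat \<Rightarrow> 'a :: comm_ring_1"
  shows "det (mat n n (\<lambda>(i,j). B i j * u j)) = det (mat n n (\<lambda>(i,j). B i j)) * (\<Prod>j<n. u j)"
proof -
  have "p j < n" if "p permutes {0..<n}" "j < n" for p j
    using that permutes_in_image[of p "{0..<n}" j] by auto
  then show ?thesis
    by (auto simp: det_col[of _ n] prod.distrib sum_distrib_right mult.assoc intro!: sum.cong prod.cong)
qed

lemma det_sum_columns:
  fixes B :: "nat \<Rightarrow> nat \<Rightarrow> 'b \<Rightarrow> 'a :: comm_ring_1"
  assumes "\<And>j. j < n \<Longrightarrow> finite (S j)"
  shows "det (mat n n (\<lambda>(i,j). \<Sum>k\<in>S j. B i j k)) =
    (\<Sum>f\<in>PiE {..<n} S. det (mat n n (\<lambda>(i,j). B i j (f j))))"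
proof -
  have p: "p j < n" if "p permutes {0..<n}" "j < n" for p j
    using that permutes_in_image[of p "{0..<n}" j] by auto
  have "det (mat n n (\<lambda>(i,j). \<Sum>k\<in>S j. B i j k)) =
      (\<Sum>p | p permutes {0..<n}. signof p * (\<Prod>j<n. \<Sum>k\<in>S j. B (p j) j k))"
    by (auto simp: det_col[of _ n] p intro!: sum.cong prod.cong)
  also have "\<dots> = (\<Sum>p | p permutes {0..<n}. \<Sum>f\<in>PiE {..<n} S. signof p * (\<Prod>j<n. B (p j) j (f j)))"
    by (intro sum.cong refl) (subst prod_sum_PiE, auto simp: assms sum_distrib_left)
  also have "\<dots> = (\<Sum>f\<in>PiE {..<n} S. \<Sum>p | p permutes {0..<n}. signof p * (\<Prod>j<n. B (p j) j (f j)))"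
    by (rule sum.swap)
  also have "\<dots> = (\<Sum>f\<in>PiE {..<n} S. det (mat n n (\<lambda>(i,j). B i j (f j))))"
    by (auto simp: det_col[of _ n] p intro!: sum.cong prod.cong)
  finally show ?thesis .
qed

lemma det_triangular_rows:
  fixes B :: "nat \<Rightarrow> nat \<Rightarrow> 'a :: comm_ring_1"
  shows "det (mat n n (\<lambda>(i,j). \<Sum>q\<le>i. c i q * B q j)) =
    (\<Prod>i<n. c i i) * det (mat n n (\<lambda>(i,j). B i j))"
proof -
  let ?C = "mat n n (\<lambda>(i,q). if q \<le> i then c i q else 0)"
  have "mat n n (\<lambda>(i,j). \<Sum>q\<le>i. c i q * B q j) = ?C * mat n n (\<lambda>(i,j). B i j)"
  proof (rule eq_matI, goal_cases)
    case (1 i j)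
    then have "(\<Sum>q\<le>i. c i q * B q j) = (\<Sum>q = 0..<n. (if q \<le> i then c i q else 0) * B q j)"
      by (intro sum.mono_neutral_cong_left) auto
    with 1 show ?case by (simp add: scalar_prod_def)
  qed auto
  moreover have "det ?C = prod_list (diag_mat ?C)"
    by (rule det_lower_triangular[of n]) auto
  moreover have "prod_list (diag_mat ?C) = (\<Prod>i<n. c i i)"
    by (auto simp: diag_mat_def prod.list_conv_set_nth atLeast0LessThan intro!: prod.cong)
  ultimately show ?thesis
    by (simp add: det_mult[of _ n])
qed

lemma det_triangular_columns:
  fixes B :: "nat \<Rightarrow> nat \<Rightarrow> 'a :: comm_ring_1"
  shows "det (mat n n (\<lambda>(i,j). \<Sum>q\<le>j. B i q * c q j)) =
    det (mat n n (\<lambda>(i,j). B i j)) * (\<Prod>j<n. c j j)"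
proof -
  have "det (mat n n (\<lambda>(i,j). \<Sum>q\<le>j. B i q * c q j)) =
      det (mat n n (\<lambda>(j,i). \<Sum>q\<le>j. c q j * B i q))"
    by (subst det_transpose[of _ n, symmetric])
       (auto simp: transpose_mat_def mult.commute intro!: arg_cong[of _ _ det] cong_mat)
  also have "\<dots> = (\<Prod>j<n. c j j) * det (mat n n (\<lambda>(j,i). B i j))"
    by (rule det_triangular_rows)
  also have "det (mat n n (\<lambda>(j,i). B i j)) = det (mat n n (\<lambda>(i,j). B i j))"
    by (subst det_transpose[of _ n, symmetric])
       (auto simp: transpose_mat_def intro!: arg_cong[of _ _ det] cong_mat)
  finally show ?thesis by (simp add: mult.commute)
qed

text \<open>Row \<open>i\<close> on the left combines the power rows up to \<open>i\<close> with the
  coefficients of \<open>p i\<close>, a triangular row operation. The later changes of row basis are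
  instances of this.\<close>

lemma det_change_polynomial_basis:
  fixes \<gamma> \<tau> :: "nat \<Rightarrow> 'b \<Rightarrow> 'a :: comm_ring_1"
  assumes deg: "\<And>i. i < n \<Longrightarrow> degree (p i) \<le> i"
  shows "det (mat n n (\<lambda>(i,j). \<Sum>k\<in>S j. \<gamma> j k * poly (p i) (\<tau> j k))) =
    (\<Prod>i<n. coeff (p i) i) * det (mat n n (\<lambda>(i,j). \<Sum>k\<in>S j. \<gamma> j k * \<tau> j k ^ i))"
proof -
  have "(\<Sum>k\<in>S j. \<gamma> j k * poly (p i) (\<tau> j k)) =
      (\<Sum>q\<le>i. coeff (p i) q * (\<Sum>k\<in>S j. \<gamma> j k * \<tau> j k ^ q))" if "i < n" for i j
  proof -
    have "poly (p i) x = (\<Sum>q\<le>i. coeff (p i) q * x ^ q)" for x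
      unfolding poly_altdef using deg[OF that]
      by (intro sum.mono_neutral_left) (auto simp: coeff_eq_0)
    then show ?thesis
      by (simp add: sum_distrib_left, subst sum.swap) (simp add: mult_ac)
  qed
  then have "mat n n (\<lambda>(i,j). \<Sum>k\<in>S j. \<gamma> j k * poly (p i) (\<tau> j k)) =
      mat n n (\<lambda>(i,j). \<Sum>q\<le>i. coeff (p i) q * (\<Sum>k\<in>S j. \<gamma> j k * \<tau> j k ^ q))"
    by (intro eq_matI) auto
  then show ?thesis
    by (simp add: det_triangular_rows)
qed

section \<open>Vandermonde products and Newton interpolation\<close>

definition vandermonde_prod :: "nat \<Rightarrow> (nat \<Rightarrow> 'a :: comm_ring_1) \<Rightarrow> 'a" where
  "vandermonde_prod n a = (\<Prod>j<n. \<Prod>i<j. a j - a i)"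

lemma degree_newton_basis: "degree (\<Prod>i<l. [:- a i, 1:] :: 'a :: comm_ring_1 poly) \<le> l"
  by (rule order.trans[OF degree_prod_sum_le])
     (auto intro!: order.trans[OF sum_mono[of _ _ "\<lambda>_. 1"]])

lemma coeff_newton_basis: "coeff (\<Prod>i<l. [:- a i, 1:] :: 'a :: comm_ring_1 poly) l = 1"
proof (induction l)
  case (Suc l)
  have "coeff (\<Prod>i<l. [:- a i, 1:]) (Suc l) = 0"
    using degree_newton_basis[of a l] by (intro coeff_eq_0) auto
  with Suc show ?case by (simp add: mult.commute)
qed auto

text \<open>In the Newton basis at the nodes the matrix is upper triangular, since basis polynomial
  \<open>l\<close> vanishes at every node of index below \<open>l\<close>.\<close>

lemma det_vandermonde:
  fixes a :: "nat \<Rightarrow> 'a :: comm_ring_1"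
  shows "det (mat n n (\<lambda>(i,j). a j ^ i)) = vandermonde_prod n a"
proof -
  define p where "p = (\<lambda>l. \<Prod>i<l. [:- a i, 1:])"
  let ?M = "mat n n (\<lambda>(i,j). poly (p i) (a j))"
  have "det ?M = det (mat n n (\<lambda>(i,j). a j ^ i))"
    using det_change_polynomial_basis[where n = n and p = p and S = "\<lambda>_. {()}" and \<gamma> = "\<lambda>_ _. 1"
        and \<tau> = "\<lambda>j _. a j"]
    by (simp add: p_def degree_newton_basis coeff_newton_basis)
  moreover have "det ?M = prod_list (diag_mat ?M)"
  proof (rule det_upper_triangular[of _ n])
    show "upper_triangular ?M"
      by (auto simp: upper_triangular_def p_def poly_prod intro!: prod_zero)
  qed auto
  moreover have "prod_list (diag_mat ?M) = vandermonde_prod n a"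
    by (auto simp: diag_mat_def prod.list_conv_set_nth atLeast0LessThan vandermonde_prod_def
        p_def poly_prod intro!: prod.cong)
  ultimately show ?thesis by simp
qed

text \<open>Successive synthetic division by monic linear factors gives the Newton coefficients
  without dividing by differences of nodes, so nodes may coincide. One \<open>c\<close> serves all
  \<open>j\<close>, which later makes column operations triangular.\<close>

lemma newton_interpolation:
  fixes p :: "'a :: comm_ring_1 poly" and a :: "nat \<Rightarrow> 'a"
  shows "\<exists>c. \<forall>j. poly p (a j) = (\<Sum>q\<le>j. c q * (\<Prod>i<q. a j - a i))"
proof -
  \<comment> \<open>\<open>P q\<close> is the quotient left after dividing by the first
    \<open>q\<close> node factors; its value at \<open>a q\<close> is the next coefficient.\<close>
  define P where "P = rec_nat p (\<lambda>q r. synthetic_div r (a q))"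
  have step: "poly (P q) x = poly (P q) (a q) + (x - a q) * poly (P (Suc q)) x" for q x
  proof -
    have "poly (P q) x = poly ([:- a q, 1:] * synthetic_div (P q) (a q) + [:poly (P q) (a q):]) x"
      by (simp only: synthetic_div_correct')
    then show ?thesis by (simp add: P_def algebra_simps)
  qed
  define c where "c q = poly (P q) (a q)" for q
  have partial: "poly p x = (\<Sum>q<m. c q * (\<Prod>i<q. x - a i)) + (\<Prod>i<m. x - a i) * poly (P m) x"
    for m x
  proof (induction m)
    case (Suc m)
    then show ?case using step[of m x] by (simp add: c_def algebra_simps)
  qed (simp add: P_def)
  have "poly p (a j) = (\<Sum>q\<le>j. c q * (\<Prod>i<q. a j - a i))" for j
    using partial[of "a j" "Suc j"] by (simp flip: lessThan_Suc_atMost)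
  then show ?thesis by blast
qed

section \<open>Power series with coefficients polynomial in a parameter\<close>

definition poly_coeffs :: "('a :: comm_ring_1 \<Rightarrow> 'a fps) \<Rightarrow> bool" where
  "poly_coeffs G \<longleftrightarrow> (\<forall>k. \<exists>p. \<forall>a. fps_nth (G a) k = poly p a)"

lemma poly_coeffs_one: "poly_coeffs (\<lambda>_. 1)"
  unfolding poly_coeffs_def
  by (intro allI exI[of _ "if _ = 0 then 1 else 0"]) auto

lemma poly_coeffs_add:
  assumes "poly_coeffs F" "poly_coeffs G"
  shows "poly_coeffs (\<lambda>a. F a + G a)"
  unfolding poly_coeffs_def
proof
  fix k
  from assms obtain p q where "\<forall>a. fps_nth (F a) k = poly p a" "\<forall>a. fps_nth (G a) k = poly q a"
    unfolding poly_coeffs_def by metis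
  then show "\<exists>p. \<forall>a. fps_nth (F a + G a) k = poly p a"
    by (intro exI[of _ "p + q"]) auto
qed

lemma poly_coeffs_mult:
  assumes "poly_coeffs F" "poly_coeffs G"
  shows "poly_coeffs (\<lambda>a. F a * G a)"
  unfolding poly_coeffs_def
proof
  fix k
  from assms obtain p q where "\<forall>k a. fps_nth (F a) k = poly (p k) a" "\<forall>k a. fps_nth (G a) k = poly (q k) a"
    unfolding poly_coeffs_def by metis
  then show "\<exists>p. \<forall>a. fps_nth (F a * G a) k = poly p a"
    by (intro exI[of _ "\<Sum>i=0..k. p i * q (k - i)"]) (auto simp: fps_mult_nth poly_sum)
qed

lemma poly_coeffs_X_deriv:
  assumes "poly_coeffs F"
  shows "poly_coeffs (\<lambda>a. - (fps_X * fps_deriv (F a)))"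
  unfolding poly_coeffs_def
proof
  fix k
  from assms obtain p where "\<forall>k a. fps_nth (F a) k = poly (p k) a"
    unfolding poly_coeffs_def by metis
  then show "\<exists>p. \<forall>a. fps_nth (- (fps_X * fps_deriv (F a))) k = poly p a"
    by (intro exI[of _ "- smult (of_nat k) (p k)"]) (cases k; simp)
qed

text \<open>Newton interpolation of every coefficient factors the matrix through an upper triangular
  one whose diagonal multiplies to the Vandermonde product. The quotient is an explicit determinant
  over the same ring.\<close>

lemma det_poly_coeffs_dvd_vandermonde:
  fixes G :: "nat \<Rightarrow> 'a :: comm_ring_1 \<Rightarrow> 'a fps"
  assumes "\<And>i. poly_coeffs (G i)"
  shows "fps_const (vandermonde_prod n a) dvd det (mat n n (\<lambda>(i,j). G i (a j)))"
proof -
  from assms obtain p where p: "fps_nth (G i x) k = poly (p i k) x" for i k x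
    unfolding poly_coeffs_def by metis
  have "\<exists>c. \<forall>i k j. poly (p i k) (a j) = (\<Sum>q\<le>j. c i k q * (\<Prod>i<q. a j - a i))"
    by (intro choice allI newton_interpolation)
  then obtain c where c: "poly (p i k) (a j) = (\<Sum>q\<le>j. c i k q * (\<Prod>i<q. a j - a i))" for i k j
    by metis
  have "G i (a j) = (\<Sum>q\<le>j. Abs_fps (\<lambda>k. c i k q) * fps_const (\<Prod>i<q. a j - a i))" for i j
    by (rule fps_ext) (simp add: p c fps_sum_nth)
  then have "det (mat n n (\<lambda>(i,j). G i (a j))) =
      det (mat n n (\<lambda>(i,j). Abs_fps (\<lambda>k. c i k j))) * (\<Prod>j<n. fps_const (\<Prod>i<j. a j - a i))"
    by (simp add: det_triangular_columns)
  moreover have "(\<Prod>j<m. fps_const (\<Prod>i<j. a j - a i)) = fps_const (vandermonde_prod m a)" for m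
    by (induction m) (auto simp: vandermonde_prod_def)
  ultimately show ?thesis by simp
qed

section \<open>The Riccati equation\<close>

text \<open>Coefficient of \<open>y ^ (e - k)\<close> in the monic Laguerre polynomial of degree
  \<open>e\<close> and parameter \<open>s\<close>. The product form also allows an indeterminate as
  parameter.\<close>

definition lag_coeff :: "'a :: comm_ring_1 \<Rightarrow> nat \<Rightarrow> nat \<Rightarrow> 'a" where
  "lag_coeff s e k = (-1) ^ k * of_nat (e choose k) * (\<Prod>i<k. of_nat e + s - of_nat i)"

lemma lag_coeff_0 [simp]: "lag_coeff s e 0 = 1"
  by (simp add: lag_coeff_def)

lemma lag_coeff_eq_0: "k > e \<Longrightarrow> lag_coeff s e k = 0"
  by (simp add: lag_coeff_def binomial_eq_0)

text \<open>Laguerre's differential equation read coefficientwise; \<open>of_nat (Suc k)\<close>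
  stays on the left because it need not be invertible.\<close>

lemma lag_coeff_Suc:
  "of_nat (Suc k) * lag_coeff s e (Suc k) =
    - ((of_nat e - of_nat k) * (of_nat e + s - of_nat k) * lag_coeff s e k)"
proof -
  have "Suc k * (e choose Suc k) = (e - k) * (e choose k)"
    using binomial_absorb_comp[of e k] binomial_absorption[of k e] by simp
  then have "of_nat (Suc k) * of_nat (e choose Suc k) = (of_nat (e - k) * of_nat (e choose k) :: 'a)"
    by (metis of_nat_mult)
  also have "\<dots> = (of_nat e - of_nat k) * of_nat (e choose k)"
    by (cases "k \<le> e") (auto simp: of_nat_diff binomial_eq_0)
  finally have "of_nat (Suc k) * of_nat (e choose Suc k) = ((of_nat e - of_nat k) * of_nat (e choose k) :: 'a)" .
  note absorb = this
  have "of_nat (Suc k) * lag_coeff s e (Suc k) =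
      - ((-1) ^ k * (of_nat (Suc k) * of_nat (e choose Suc k)) * (\<Prod>i<Suc k. of_nat e + s - of_nat i))"
    by (simp add: lag_coeff_def mult_ac del: of_nat_Suc binomial_Suc_Suc)
  then show ?thesis
    unfolding absorb by (simp add: lag_coeff_def mult_ac)
qed

text \<open>A series \<open>f\<close> in \<open>z = 1/y\<close> stands for \<open>y\<^sup>a f\<close>; on these, \<open>y d/dy\<close> acts as follows.\<close>
definition euler :: "'a :: comm_ring_1 \<Rightarrow> 'a fps \<Rightarrow> 'a fps" where
  "euler a f = fps_const a * f - fps_X * fps_deriv f"

lemma fps_nth_euler [simp]: "fps_nth (euler a f) k = (a - of_nat k) * fps_nth f k"
  by (cases k) (auto simp: euler_def algebra_simps)

lemma fps_nth_euler_funpow: "fps_nth ((euler a ^^ l) f) k = (a - of_nat k) ^ l * fps_nth f k"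
  by (induction l) (auto simp: mult_ac)

lemma euler_mult: "euler a (f * g) = f * euler a g - fps_X * fps_deriv f * g"
  by (simp add: euler_def algebra_simps)

text \<open>Because of the factor \<open>fps_X\<close>, coefficient \<open>k\<close> of the right
  side depends only on coefficients of \<open>h\<close> below \<open>k\<close>.\<close>

lemma fps_eq_0_if_contraction:
  fixes h :: "'a :: comm_ring_1 fps"
  assumes "h = fps_X * (euler a h + g * h)"
  shows "h = 0"
proof -
  have "fps_nth h k = 0" for k
  proof (induction k rule: less_induct)
    case (less k)
    have eq: "fps_nth h k = fps_nth (fps_X * (euler a h + g * h)) k"
      by (subst assms) (rule refl)
    show ?case
    proof (cases k)
      case 0
      with eq show ?thesis by simp
    next
      case (Suc k')
      with less have "fps_nth h i = 0" if "i \<le> k'" for i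
        using that by simp
      moreover have "fps_nth h k = fps_nth (euler a h + g * h) k'"
        by (subst eq) (simp add: Suc del: fps_add_nth)
      ultimately show ?thesis by (simp add: fps_mult_nth)
    qed
  qed
  then show ?thesis by (simp add: fps_eq_iff)
qed

text \<open>The recursion comes from comparing coefficients in \<open>riccati_eq\<close>. It
  involves no division, so its values are integral polynomials in \<open>a\<close> and
  \<open>b\<close>.\<close>

function riccati_coeff :: "'a :: comm_ring_1 \<Rightarrow> 'a \<Rightarrow> nat \<Rightarrow> 'a" where
  "riccati_coeff b a 0 = a"
| "riccati_coeff b a (Suc k) = (\<Sum>i=0..k. riccati_coeff b a i * riccati_coeff b a (k - i))
    - of_nat k * riccati_coeff b a k - b * riccati_coeff b a k"
  by pat_completeness auto
termination by (relation "measure (\<lambda>(b, a, k). k)") auto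

definition riccati :: "'a :: comm_ring_1 \<Rightarrow> 'a \<Rightarrow> 'a fps" where
  "riccati b a = Abs_fps (riccati_coeff b a)"

text \<open>This is the Laguerre equation divided by its solution \<open>f\<close>, for the ratio r
  of \<open>euler a f\<close> to \<open>f\<close>: the second Euler derivative becomes r^2 - X
  r'.\<close>

lemma riccati_eq:
  "riccati b a = fps_const a + fps_X * ((riccati b a)\<^sup>2 - fps_X * fps_deriv (riccati b a) - fps_const b * riccati b a)"
proof (rule fps_ext)
  fix k
  show "fps_nth (riccati b a) k = fps_nth (fps_const a +
     fps_X * ((riccati b a)\<^sup>2 - fps_X * fps_deriv (riccati b a) - fps_const b * riccati b a)) k"
  proof (cases k)
    case (Suc k')
    have "fps_nth (fps_X * fps_deriv (riccati b a)) k' = of_nat k' * riccati_coeff b a k'"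
      by (cases k') (simp_all add: riccati_def del: riccati_coeff.simps)
    moreover have "fps_nth ((riccati b a)\<^sup>2) k' = (\<Sum>i=0..k'. riccati_coeff b a i * riccati_coeff b a (k' - i))"
      by (simp add: power2_eq_square fps_mult_nth riccati_def)
    ultimately have "fps_nth (fps_X * ((riccati b a)\<^sup>2 - fps_X * fps_deriv (riccati b a) - fps_const b * riccati b a)) (Suc k')
        = riccati_coeff b a (Suc k')"
      by (simp add: riccati_def del: power2_eq_square)
    then show ?thesis
      by (simp add: Suc riccati_def del: riccati_coeff.simps)
  qed (simp add: riccati_def)
qed

lemma riccati_coeff_poly: "\<exists>p. \<forall>a. riccati_coeff b a k = poly p a"
proof (induction k rule: less_induct)
  case (less k)
  show ?case
  proof (cases k)
    case 0
    then show ?thesis by (intro exI[of _ "[:0, 1:]"]) auto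
  next
    case (Suc k')
    with less have "\<forall>i\<in>{..k'}. \<exists>p. \<forall>a. riccati_coeff b a i = poly p a" by auto
    then obtain p where p: "\<And>i a. i \<le> k' \<Longrightarrow> riccati_coeff b a i = poly (p i) a"
      by (metis atMost_iff)
    then show ?thesis
      by (intro exI[of _ "(\<Sum>i=0..k'. p i * p (k' - i)) - of_nat k' * p k' - smult b (p k')"])
         (simp add: Suc poly_sum)
  qed
qed

lemma poly_coeffs_riccati: "poly_coeffs (riccati b)"
  using riccati_coeff_poly by (auto simp: poly_coeffs_def riccati_def)

text \<open>The would-be quotient of \<open>(euler a ^^ l) f\<close> by \<open>f\<close>, written
  through the Riccati series alone so that \<open>f\<close> no longer enters.\<close>

primrec riccati_iter :: "'a :: comm_ring_1 \<Rightarrow> nat \<Rightarrow> 'a \<Rightarrow> 'a fps" where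
  "riccati_iter b 0 a = 1"
| "riccati_iter b (Suc l) a = - (fps_X * fps_deriv (riccati_iter b l a)) + riccati b a * riccati_iter b l a"

lemma poly_coeffs_riccati_iter: "poly_coeffs (riccati_iter b l)"
proof (induction l)
  case (Suc l)
  have eq: "riccati_iter b (Suc l) =
      (\<lambda>a. - (fps_X * fps_deriv (riccati_iter b l a)) + riccati b a * riccati_iter b l a)"
    by (rule ext) (rule riccati_iter.simps)
  show ?case
    unfolding eq by (intro poly_coeffs_add poly_coeffs_mult poly_coeffs_X_deriv poly_coeffs_riccati Suc)
next
  case 0
  have "riccati_iter b 0 = (\<lambda>_. 1)" by (simp add: fun_eq_iff)
  then show ?case using poly_coeffs_one by simp
qed

text \<open>The defect \<open>h\<close> of the first-order relation
  \<open>euler a f = riccati b a * f\<close> obeys a contraction equation and so vanishes; nothing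
  is divided by \<open>f\<close>. Higher Euler derivatives follow by the product rule.\<close>

lemma euler_funpow_eq_riccati_iter:
  fixes f :: "'a :: comm_ring_1 fps"
  assumes ode: "fps_X * (euler a (euler a f) - fps_const b * euler a f) = euler a f - fps_const a * f"
  shows "(euler a ^^ l) f = riccati_iter b l a * f"
proof -
  let ?r = "riccati b a"
  define h where "h = euler a f - ?r * f"
  have rf: "?r * f = fps_const a * f + fps_X * (?r\<^sup>2 * f - fps_X * fps_deriv ?r * f - fps_const b * ?r * f)"
    by (subst riccati_eq) (simp add: algebra_simps)
  have eh: "euler a h = euler a (euler a f) - ?r * euler a f + fps_X * fps_deriv ?r * f"
    unfolding h_def using euler_mult[of a ?r f] by (simp add: euler_def algebra_simps)
  have "h = fps_X * (euler a (euler a f) - fps_const b * euler a f)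
      - fps_X * (?r\<^sup>2 * f - fps_X * fps_deriv ?r * f - fps_const b * ?r * f)"
    unfolding h_def ode using rf by (simp add: algebra_simps)
  also have "\<dots> = fps_X * (euler a h + (?r - fps_const b) * h)"
    unfolding eh unfolding h_def by (simp add: algebra_simps power2_eq_square)
  finally have "h = 0" by (rule fps_eq_0_if_contraction)
  then have h: "euler a f = ?r * f" by (simp add: h_def)
  show ?thesis
  proof (induction l)
    case (Suc l)
    have "(euler a ^^ Suc l) f = euler a (riccati_iter b l a * f)"
      using Suc by simp
    also have "\<dots> = riccati_iter b (Suc l) a * f"
      unfolding euler_mult h by (simp add: algebra_simps)
    finally show ?case .
  qed simp
qed

section \<open>Expansion of the Wronskian determinant\<close>

definition col_deg :: "nat list \<Rightarrow> nat list \<Rightarrow> nat \<Rightarrow> nat" where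
  "col_deg ms ns j = (ms @ ns) ! j"

text \<open>Columns are indexed by \<open>ms @ ns\<close>.  Column \<open>j\<close> of the first block belongs to
  \<open>y\<^sup>\<beta> L\<^sub>m\<^sup>(\<^sup>\<beta>\<^sup>)(y)\<close>, of the second block to \<open>L\<^sub>n\<^sup>(\<^sup>-\<^sup>\<beta>\<^sup>)(y)\<close>; its terms are \<open>col_coeff b ms ns j k\<close> times
  \<open>y\<close> to the power \<open>col_exp b ms ns j - k\<close>.\<close>
definition col_exp :: "'a :: comm_ring_1 \<Rightarrow> nat list \<Rightarrow> nat list \<Rightarrow> nat \<Rightarrow> 'a" where
  "col_exp b ms ns j = of_nat (col_deg ms ns j) + (if j < length ms then b else 0)"

definition col_coeff :: "'a :: comm_ring_1 \<Rightarrow> nat list \<Rightarrow> nat list \<Rightarrow> nat \<Rightarrow> nat \<Rightarrow> 'a" where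
  "col_coeff b ms ns j k = lag_coeff (if j < length ms then b else - b) (col_deg ms ns j) k"

text \<open>The coefficient of \<open>y\<close> to the power total degree minus \<open>K\<close> in
  the determinant: \<open>f\<close> chooses one term per column, \<open>K\<close> is the total drop
  in degree, and each choice leaves a Vandermonde determinant in the shifted exponents.\<close>

definition wr_coeff :: "'a :: comm_ring_1 \<Rightarrow> nat list \<Rightarrow> nat list \<Rightarrow> nat \<Rightarrow> 'a" where
  "wr_coeff b ms ns K = (let N = length ms + length ns in
     \<Sum>f\<in>{f \<in> PiE {..<N} (\<lambda>j. {..col_deg ms ns j}). (\<Sum>j<N. f j) = K}.
       (\<Prod>j<N. col_coeff b ms ns j (f j)) * vandermonde_prod N (\<lambda>j. col_exp b ms ns j - of_nat (f j)))"

lemma det_sum_of_powers: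
  fixes u v :: "nat \<Rightarrow> nat \<Rightarrow> 'a :: comm_ring_1"
  shows "det (mat n n (\<lambda>(l,j). \<Sum>k\<le>e j. u j k * v j k ^ l)) =
    (\<Sum>f\<in>PiE {..<n} (\<lambda>j. {..e j}). (\<Prod>j<n. u j (f j)) * vandermonde_prod n (\<lambda>j. v j (f j)))"
proof -
  have "det (mat n n (\<lambda>(l,j). \<Sum>k\<le>e j. u j k * v j k ^ l)) =
    (\<Sum>f\<in>PiE {..<n} (\<lambda>j. {..e j}). det (mat n n (\<lambda>(l,j). u j (f j) * v j (f j) ^ l)))"
    by (subst det_sum_columns) auto
  also have "\<dots> = (\<Sum>f\<in>PiE {..<n} (\<lambda>j. {..e j}). (\<Prod>j<n. u j (f j)) * vandermonde_prod n (\<lambda>j. v j (f j)))"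
  proof (rule sum.cong[OF refl], goal_cases)
    case (1 f)
    show ?case
      using det_scale_columns[of n "\<lambda>l j. v j (f j) ^ l" "\<lambda>j. u j (f j)"]
      by (simp add: det_vandermonde[of n "\<lambda>j. v j (f j)"] mult.commute)
  qed
  finally show ?thesis .
qed

lemma vandermonde_prod_eq_0:
  assumes "i < n" "j < n" "i \<noteq> j" "a i = a j"
  shows "vandermonde_prod n a = 0"
proof -
  have *: "vandermonde_prod n a = 0" if "i < j" "j < n" "a i = a j" for i j
  proof -
    have "(\<Prod>i<j. a j - a i) = 0"
      using that by (intro prod_zero bexI[of _ i]) auto
    then show ?thesis
      unfolding vandermonde_prod_def using that by (auto intro: prod_zero)
  qed
  show ?thesis using assms *[of i j] *[of j i] by (cases "i < j") auto
qed

lemma vandermonde_prod_nonzero: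
  fixes a :: "nat \<Rightarrow> 'a :: idom"
  assumes "\<And>i j. i < j \<Longrightarrow> j < n \<Longrightarrow> a i \<noteq> a j"
  shows "vandermonde_prod n a \<noteq> 0"
  unfolding vandermonde_prod_def using assms by (fastforce simp: prod_zero_iff)

lemma fps_const_vandermonde_prod:
  "vandermonde_prod n (\<lambda>j. fps_const (a j)) = fps_const (vandermonde_prod n a)"
proof -
  have *: "(\<Prod>i\<in>A. fps_const (g i)) = fps_const (\<Prod>i\<in>A. g i)" if "finite A" for g :: "nat \<Rightarrow> 'a" and A
    using that by (induction A rule: finite_induct) auto
  show ?thesis by (simp add: vandermonde_prod_def *)
qed

lemma fps_col_eq_sum:
  "Abs_fps (\<lambda>k. col_coeff b ms ns j k * g k) =
    (\<Sum>k\<le>col_deg ms ns j. fps_const (col_coeff b ms ns j k * g k) * fps_X ^ k)"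
  by (rule fps_ext) (auto simp: fps_sum_nth fps_X_power_iff if_distrib[of "\<lambda>x. _ * x"] sum.delta col_coeff_def lag_coeff_eq_0
      cong: if_cong)

text \<open>The formal variable records the drop in degree, so choices with total drop
  \<open>K\<close> are collected at \<open>fps_X ^ K\<close>. This brings \<open>wr_coeff\<close>
  within reach of the Riccati argument.\<close>

lemma det_series_columns:
  fixes b :: "'a :: comm_ring_1"
  assumes N: "N = length ms + length ns"
  shows "det (mat N N (\<lambda>(l,j). Abs_fps (\<lambda>k. col_coeff b ms ns j k * (col_exp b ms ns j - of_nat k) ^ l))) =
    Abs_fps (wr_coeff b ms ns)"
proof -
  let ?u = "\<lambda>j k. fps_const (col_coeff b ms ns j k) * fps_X ^ k"
  let ?v = "\<lambda>j k. fps_const (col_exp b ms ns j - of_nat k)"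
  let ?F = "PiE {..<N} (\<lambda>j. {..col_deg ms ns j})"
  let ?t = "\<lambda>f. (\<Prod>j<N. col_coeff b ms ns j (f j)) * vandermonde_prod N (\<lambda>j. col_exp b ms ns j - of_nat (f j))"
  have fin: "finite ?F" by (intro finite_PiE) auto
  have prod_u: "(\<Prod>j<n. ?u j (f j)) = fps_const (\<Prod>j<n. col_coeff b ms ns j (f j)) * fps_X ^ (\<Sum>j<n. f j)" for f n
    by (induction n) (auto simp: power_add fps_const_mult[symmetric] mult_ac simp del: fps_const_mult)
  have "Abs_fps (\<lambda>k. col_coeff b ms ns j k * (col_exp b ms ns j - of_nat k) ^ l) =
      (\<Sum>k\<le>col_deg ms ns j. ?u j k * ?v j k ^ l)" for j l
    by (subst fps_col_eq_sum) (auto intro!: sum.cong simp: fps_const_mult[symmetric] fps_const_power mult_ac simp del: fps_const_mult)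
  then have "det (mat N N (\<lambda>(l,j). Abs_fps (\<lambda>k. col_coeff b ms ns j k * (col_exp b ms ns j - of_nat k) ^ l))) =
      (\<Sum>f\<in>?F. (\<Prod>j<N. ?u j (f j)) * vandermonde_prod N (\<lambda>j. ?v j (f j)))"
    by (simp only: det_sum_of_powers)
  also have "\<dots> = (\<Sum>f\<in>?F. fps_const (?t f) * fps_X ^ (\<Sum>j<N. f j))"
    unfolding prod_u fps_const_vandermonde_prod fps_const_mult[symmetric] by (simp only: mult_ac)
  also have "\<dots> = Abs_fps (wr_coeff b ms ns)"
  proof (rule fps_ext)
    fix K
    have "fps_nth (\<Sum>f\<in>?F. fps_const (?t f) * fps_X ^ (\<Sum>j<N. f j)) K =
        (\<Sum>f\<in>?F. if (\<Sum>j<N. f j) = K then ?t f else 0)"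
      unfolding fps_sum_nth by (intro sum.cong refl) (simp add: fps_X_power_iff)
    also have "\<dots> = wr_coeff b ms ns K"
      unfolding wr_coeff_def Let_def N[symmetric] by (rule sum.inter_filter[OF fin, symmetric])
    finally show "fps_nth (\<Sum>f\<in>?F. fps_const (?t f) * fps_X ^ (\<Sum>j<N. f j)) K =
        fps_nth (Abs_fps (wr_coeff b ms ns)) K" by simp
  qed
  finally show ?thesis .
qed

text \<open>The product of the column series factors out of the determinant of Euler derivatives,
  leaving columns polynomial in the exponent. Divisibility by a constant series is divisibility of
  every coefficient.\<close>

lemma vandermonde_dvd_wr_coeff:
  fixes b :: "'a :: comm_ring_1"
  assumes N: "N = length ms + length ns"
  shows "vandermonde_prod N (col_exp b ms ns) dvd wr_coeff b ms ns K"
proof -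
  let ?a = "col_exp b ms ns" and ?f = "\<lambda>j. Abs_fps (col_coeff b ms ns j)"
  \<comment> \<open>With degree e, Laguerre parameter s and exponent a, the factors e - k and e + s
    - k of the recurrence are a - b - k and a - k in the first block and trade places in the second,
    so one equation serves both.\<close>
  have ode: "fps_X * (euler (?a j) (euler (?a j) (?f j)) - fps_const b * euler (?a j) (?f j)) =
      euler (?a j) (?f j) - fps_const (?a j) * ?f j" for j
  proof (rule fps_ext)
    fix k
    show "fps_nth (fps_X * (euler (?a j) (euler (?a j) (?f j)) - fps_const b * euler (?a j) (?f j))) k =
      fps_nth (euler (?a j) (?f j) - fps_const (?a j) * ?f j) k"
    proof (cases k)
      case (Suc k')
      have "- (of_nat (Suc k') * col_coeff b ms ns j (Suc k')) =
          (?a j - of_nat k') * (?a j - b - of_nat k') * col_coeff b ms ns j k'"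
        unfolding col_coeff_def lag_coeff_Suc by (simp add: col_exp_def algebra_simps)
      with Suc show ?thesis by (simp add: algebra_simps)
    qed simp
  qed
  have "Abs_fps (\<lambda>k. col_coeff b ms ns j k * (?a j - of_nat k) ^ l) = riccati_iter b l (?a j) * ?f j" for j l
    by (subst euler_funpow_eq_riccati_iter[OF ode, symmetric])
       (simp add: fps_eq_iff fps_nth_euler_funpow mult.commute)
  then have "Abs_fps (wr_coeff b ms ns) = det (mat N N (\<lambda>(l,j). riccati_iter b l (?a j))) * (\<Prod>j<N. ?f j)"
    by (simp only: det_series_columns[OF N, symmetric] det_scale_columns)
  moreover have "fps_const (vandermonde_prod N ?a) dvd det (mat N N (\<lambda>(l,j). riccati_iter b l (?a j)))"
    by (intro det_poly_coeffs_dvd_vandermonde poly_coeffs_riccati_iter)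
  ultimately have "fps_const (vandermonde_prod N ?a) dvd Abs_fps (wr_coeff b ms ns)"
    by simp
  then obtain g where "Abs_fps (wr_coeff b ms ns) = fps_const (vandermonde_prod N ?a) * g"
    by (rule dvdE)
  then have "fps_nth (Abs_fps (wr_coeff b ms ns)) K = fps_nth (fps_const (vandermonde_prod N ?a) * g) K"
    by (rule arg_cong)
  then have "wr_coeff b ms ns K = vandermonde_prod N ?a * fps_nth g K"
    by simp
  then show ?thesis by simp
qed

lemma wr_coeff_0:
  assumes N: "N = length ms + length ns"
  shows "wr_coeff b ms ns 0 = vandermonde_prod N (col_exp b ms ns)"
proof -
  have "{f \<in> PiE {..<N} (\<lambda>j. {..col_deg ms ns j}). (\<Sum>j<N. f j) = 0} = {\<lambda>j\<in>{..<N}. 0}"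
    by (auto simp: PiE_def extensional_def fun_eq_iff)
  \<comment> \<open>The choice function is \<open>undefined\<close> outside \<open>{..<N}\<close>,
    but the Vandermonde product only reads indices below \<open>N\<close>.\<close>
  moreover have "vandermonde_prod N (\<lambda>j. col_exp b ms ns j - of_nat (if j < N then 0 else undefined)) =
     vandermonde_prod N (col_exp b ms ns)"
    unfolding vandermonde_prod_def by (intro prod.cong refl) auto
  ultimately show ?thesis
    by (simp add: wr_coeff_def Let_def N[symmetric] col_coeff_def restrict_def)
qed

lemma sum_lessThan_card_le:
  fixes A :: "nat set"
  assumes "finite A"
  shows "(\<Sum>i<card A. i) \<le> \<Sum>A"
  using assms
proof (induction "card A" arbitrary: A)
  case (Suc n)
  then have "A \<noteq> {}" by auto
  with Suc have A: "Max A \<in> A" by simp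
  have "A \<subseteq> {..Max A}" using Suc by auto
  then have "card A \<le> Suc (Max A)" using card_mono[of "{..Max A}" A] by simp
  moreover have "(\<Sum>i<n. i) \<le> \<Sum>(A - {Max A})"
    using Suc A by (metis card_Diff_singleton diff_Suc_1 finite_Diff)
  moreover have "\<Sum>A = Max A + \<Sum>(A - {Max A})"
    using Suc A by (simp add: sum.remove)
  moreover have "card A = Suc n" using Suc(2) by simp
  ultimately show ?case by simp
qed simp

lemma sum_lessThan_card_le_inj:
  fixes g :: "nat \<Rightarrow> nat"
  assumes "inj_on g A" "finite A"
  shows "(\<Sum>i<card A. i) \<le> sum g A"
  using sum_lessThan_card_le[of "g ` A"] assms by (simp add: card_image sum.reindex)

text \<open>For such \<open>K\<close> the remaining degrees \<open>col_deg ms ns j - f j\<close>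
  have a smaller sum than distinct degrees within each block would need. Two columns of one block
  then share an exponent, and each Vandermonde term vanishes.\<close>

lemma wr_coeff_eq_0:
  assumes N: "N = length ms + length ns"
    and K: "(\<Sum>j<N. col_deg ms ns j) < K + ((\<Sum>i<length ms. i) + (\<Sum>i<length ns. i))"
  shows "wr_coeff b ms ns K = 0"
  unfolding wr_coeff_def Let_def N[symmetric]
proof (rule sum.neutral, rule ballI, goal_cases)
  case (1 f)
  let ?g = "\<lambda>j. col_deg ms ns j - f j"
  have f: "f j \<le> col_deg ms ns j" if "j < N" for j
    using 1 that by (auto simp: PiE_def Pi_def)
  have split: "{..<N} = {..<length ms} \<union> {length ms..<N}" using N by auto
  have "(\<Sum>j<N. ?g j) + K = (\<Sum>j<N. col_deg ms ns j)"
    using 1 f by (auto simp flip: sum.distrib)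
  with K have "(\<Sum>j<N. ?g j) < (\<Sum>i<length ms. i) + (\<Sum>i<length ns. i)" by simp
  moreover have "(\<Sum>j<N. ?g j) = (\<Sum>j<length ms. ?g j) + (\<Sum>j\<in>{length ms..<N}. ?g j)"
    unfolding split by (rule sum.union_disjoint) auto
  ultimately have "\<not> (inj_on ?g {..<length ms} \<and> inj_on ?g {length ms..<N})"
    using sum_lessThan_card_le_inj[of ?g "{..<length ms}"] sum_lessThan_card_le_inj[of ?g "{length ms..<N}"] N
    by auto
  then have "\<exists>i j. i < N \<and> j < N \<and> i \<noteq> j \<and> ?g i = ?g j \<and> (i < length ms \<longleftrightarrow> j < length ms)"
  proof (cases "inj_on ?g {..<length ms}")
    case False
    then obtain i j where "i < length ms" "j < length ms" "i \<noteq> j" "?g i = ?g j"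
      by (auto simp only: inj_on_def lessThan_iff)
    then show ?thesis using N by (intro exI[of _ i] exI[of _ j]) auto
  next
    case True
    with \<open>\<not> (_ \<and> _)\<close> have "\<not> inj_on ?g {length ms..<N}" by blast
    then obtain i j where "i \<in> {length ms..<N}" "j \<in> {length ms..<N}" "i \<noteq> j" "?g i = ?g j"
      by (auto simp only: inj_on_def)
    then show ?thesis by (intro exI[of _ i] exI[of _ j]) auto
  qed
  then obtain i j where ij: "i < N" "j < N" "i \<noteq> j" "?g i = ?g j" "i < length ms \<longleftrightarrow> j < length ms"
    by blast
  have val: "col_exp b ms ns j - of_nat (f j) = of_nat (?g j) + (if j < length ms then b else 0)" if "j < N" for j
    using f[OF that] by (simp add: col_exp_def of_nat_diff)
  have "vandermonde_prod N (\<lambda>j. col_exp b ms ns j - of_nat (f j)) = 0"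
    by (rule vandermonde_prod_eq_0[of i N j]) (use ij val in auto)
  then show ?case by simp
qed

definition wr_det :: "'a :: comm_ring_1 \<Rightarrow> nat list \<Rightarrow> nat list \<Rightarrow> 'a \<Rightarrow> 'a" where
  "wr_det b ms ns y = (let N = length ms + length ns in det (mat N N (\<lambda>(l,j). \<Sum>k\<le>col_deg ms ns j.
     col_coeff b ms ns j k * y ^ (col_deg ms ns j - k) * (col_exp b ms ns j - of_nat k) ^ l)))"

lemma wr_det_expansion:
  assumes N: "N = length ms + length ns" and E: "E = (\<Sum>j<N. col_deg ms ns j)"
  shows "wr_det b ms ns y = (\<Sum>K\<le>E. wr_coeff b ms ns K * y ^ (E - K))"
proof -
  let ?F = "PiE {..<N} (\<lambda>j. {..col_deg ms ns j})"
  let ?t = "\<lambda>f. (\<Prod>j<N. col_coeff b ms ns j (f j)) * vandermonde_prod N (\<lambda>j. col_exp b ms ns j - of_nat (f j))"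
  have fin: "finite ?F" by (intro finite_PiE) auto
  have f: "f j \<le> col_deg ms ns j" if "f \<in> ?F" "j < N" for f j
    using that by (auto simp: PiE_def Pi_def)
  have E_diff: "(\<Sum>j<N. col_deg ms ns j - f j) = E - (\<Sum>j<N. f j)" if "f \<in> ?F" for f
    unfolding E using f[OF that] by (intro sum_subtractf_nat) auto
  have le_E: "(\<Sum>j<N. f j) \<in> {..E}" if "f \<in> ?F" for f
    unfolding E using f[OF that] by (auto intro: sum_mono)
  have "wr_det b ms ns y = (\<Sum>f\<in>?F. (\<Prod>j<N. col_coeff b ms ns j (f j) * y ^ (col_deg ms ns j - f j)) *
      vandermonde_prod N (\<lambda>j. col_exp b ms ns j - of_nat (f j)))"
    unfolding wr_det_def Let_def N[symmetric] by (rule det_sum_of_powers)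
  also have "\<dots> = (\<Sum>f\<in>?F. ?t f * y ^ (E - (\<Sum>j<N. f j)))"
    by (intro sum.cong refl) (simp add: prod.distrib power_sum[symmetric] E_diff mult_ac)
  also have "\<dots> = (\<Sum>K\<le>E. \<Sum>f\<in>{f\<in>?F. (\<Sum>j<N. f j) = K}. ?t f * y ^ (E - (\<Sum>j<N. f j)))"
    using fin le_E by (intro sum.group[symmetric]) auto
  also have "\<dots> = (\<Sum>K\<le>E. wr_coeff b ms ns K * y ^ (E - K))"
    unfolding wr_coeff_def Let_def N[symmetric] by (simp add: sum_distrib_right)
  finally show ?thesis .
qed

section \<open>Existence of the integral polynomial\<close>

context comm_ring_hom begin

lemma hom_lag_coeff: "hom (lag_coeff s e k) = lag_coeff (hom s) e k"
  by (simp add: lag_coeff_def hom_distribs)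

lemma hom_vandermonde_prod: "hom (vandermonde_prod n a) = vandermonde_prod n (\<lambda>j. hom (a j))"
  by (simp add: vandermonde_prod_def hom_distribs)

lemma hom_wr_coeff: "hom (wr_coeff b ms ns K) = wr_coeff (hom b) ms ns K"
proof -
  have exp: "hom (col_exp b ms ns j - of_nat k) = col_exp (hom b) ms ns j - of_nat k" for j k
    by (simp add: col_exp_def hom_distribs)
  have coeff: "hom (col_coeff b ms ns j k) = col_coeff (hom b) ms ns j k" for j k
    by (simp add: col_coeff_def hom_lag_coeff hom_distribs)
  show ?thesis
    by (simp add: wr_coeff_def Let_def hom_sum hom_mult hom_prod hom_vandermonde_prod exp coeff)
qed

end

abbreviation eval_int_poly :: "real \<Rightarrow> int poly \<Rightarrow> real" where
  "eval_int_poly b c \<equiv> poly (map_poly of_int c) b"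

lemma comm_ring_hom_eval_int_poly: "comm_ring_hom (eval_int_poly b)"
proof -
  have "map_poly of_int (p + q) = map_poly of_int p + (map_poly of_int q :: real poly)" for p q
    by (rule poly_eqI) (simp add: coeff_map_poly)
  moreover have "map_poly of_int (p * q) = map_poly of_int p * (map_poly of_int q :: real poly)" for p q
    by (rule poly_eqI) (simp add: coeff_map_poly coeff_mult)
  ultimately show ?thesis
    by unfold_locales simp_all
qed

lemma poly_eval_beta:
  assumes "degree P \<le> n"
  shows "poly (eval_beta P b) y = (\<Sum>i\<le>n. eval_int_poly b (coeff P i) * y ^ i)"
proof -
  have "degree (eval_beta P b) \<le> n"
    unfolding eval_beta_def using assms map_poly_degree_leq order.trans by blast
  then have "poly (eval_beta P b) y = (\<Sum>i\<le>n. coeff (eval_beta P b) i * y ^ i)"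
    unfolding poly_altdef by (intro sum.mono_neutral_left) (auto simp: coeff_eq_0)
  then show ?thesis by (simp add: eval_beta_def coeff_map_poly)
qed

text \<open>For indeterminate beta, exponents from different blocks differ in their linear
  coefficient, so the collisions possible at integer beta do not occur and the Vandermonde product
  can be cancelled.\<close>

lemma col_exp_generic:
  assumes "distinct ms" "distinct ns" "i < j" "j < length ms + length ns"
  shows "col_exp ([:0, 1:] :: int poly) ms ns i \<noteq> col_exp [:0, 1:] ms ns j"
  using assms
  by (auto simp: col_exp_def col_deg_def nth_append of_nat_poly nth_eq_iff_index_eq)

definition tri :: "nat \<Rightarrow> nat" where "tri n = (\<Sum>i<n. i)"

text \<open>\<open>P\<close> collects the quotients of \<open>wr_coeff\<close> by the Vandermonde
  product over the integral polynomials in beta. It is monic because the quotient at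
  \<open>K = 0\<close> is 1; the power of \<open>y\<close> splits off because the coefficients
  vanish for large \<open>K\<close>.\<close>

lemma wr_det_factorization:
  assumes "distinct ms" "distinct ns" and N: "N = length ms + length ns"
  obtains P :: "int poly poly" where "lead_coeff P = 1"
    "\<And>b y. wr_det b ms ns y =
       vandermonde_prod N (col_exp b ms ns) * y ^ (tri (length ms) + tri (length ns)) * poly (eval_beta P b) y"
proof -
  let ?\<beta> = "[:0, 1:] :: int poly"
  define V where "V = vandermonde_prod N (col_exp ?\<beta> ms ns)"
  define E where "E = (\<Sum>j<N. col_deg ms ns j)"
  define c where "c = tri (length ms) + tri (length ns)"
  define D where "D = E - c"
  have V: "V \<noteq> 0"
    unfolding V_def using assms by (intro vandermonde_prod_nonzero col_exp_generic) auto
  have zero: "wr_coeff b ms ns K = 0" if "E < K + c" for b :: "'a :: comm_ring_1" and K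
    using wr_coeff_eq_0[OF N, of K b] that by (simp add: E_def c_def tri_def)
  obtain Q where Q: "\<And>K. wr_coeff ?\<beta> ms ns K = V * Q K"
    using vandermonde_dvd_wr_coeff[OF N, of ?\<beta>] unfolding V_def dvd_def by metis
  have wr0: "wr_coeff ?\<beta> ms ns 0 = V"
    unfolding V_def by (rule wr_coeff_0[OF N])
  have Q0: "Q 0 = 1" using Q[of 0] V wr0 by simp
  have "c \<le> E" using zero[of 0 ?\<beta>] wr0 V by (cases "c \<le> E") auto
  then have E: "E = D + c" by (simp add: D_def)
  define P where "P = (\<Sum>i\<le>D. monom (Q (D - i)) i)"
  have coeff_P: "coeff P i = (if i \<le> D then Q (D - i) else 0)" for i
    by (simp add: P_def coeff_sum)
  have deg: "degree P = D"
    by (rule antisym[OF degree_le le_degree]) (auto simp: coeff_P Q0)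
  have "wr_det b ms ns y = vandermonde_prod N (col_exp b ms ns) * y ^ c * poly (eval_beta P b) y" for b y
  proof -
    interpret comm_ring_hom "eval_int_poly b" by (rule comm_ring_hom_eval_int_poly)
    have hom_\<beta>: "eval_int_poly b ?\<beta> = b" by (simp add: map_poly_pCons)
    have hom_V: "eval_int_poly b V = vandermonde_prod N (col_exp b ms ns)"
    proof -
      have "eval_int_poly b (col_exp ?\<beta> ms ns j) = col_exp b ms ns j" for j
        unfolding col_exp_def hom_add hom_of_nat using hom_\<beta> by (cases "j < length ms") simp_all
      then show ?thesis unfolding V_def hom_vandermonde_prod by simp
    qed
    \<comment> \<open>The specialised Vandermonde product may be zero, so the relation is kept as a
      product.\<close>
    have wr: "wr_coeff b ms ns K = vandermonde_prod N (col_exp b ms ns) * eval_int_poly b (Q K)" for K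
      using arg_cong[OF Q[of K], of "eval_int_poly b"] hom_V unfolding hom_wr_coeff hom_mult hom_\<beta> by simp
    have "wr_det b ms ns y = (\<Sum>K\<le>E. wr_coeff b ms ns K * y ^ (E - K))"
      by (rule wr_det_expansion[OF N E_def])
    also have "\<dots> = (\<Sum>K\<le>D. wr_coeff b ms ns K * y ^ (E - K))"
      using zero[of _ b] by (intro sum.mono_neutral_right) (auto simp: E)
    also have "\<dots> = (\<Sum>i\<le>D. wr_coeff b ms ns (D - i) * y ^ (i + c))"
      by (rule sum.reindex_bij_witness[of _ "\<lambda>i. D - i" "\<lambda>i. D - i"]) (auto simp: E)
    also have "\<dots> = vandermonde_prod N (col_exp b ms ns) * y ^ c * (\<Sum>i\<le>D. eval_int_poly b (Q (D - i)) * y ^ i)"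
      by (simp add: wr sum_distrib_left power_add mult_ac)
    also have "(\<Sum>i\<le>D. eval_int_poly b (Q (D - i)) * y ^ i) = poly (eval_beta P b) y"
      by (simp add: poly_eval_beta[of P D] deg coeff_P)
    finally show ?thesis .
  qed
  with Q0 deg show ?thesis
    by (intro that[of P]) (auto simp: c_def coeff_P)
qed

section \<open>From Wronskians to power sums\<close>

text \<open>The \<open>i\<close>-th derivative of \<open>exp (- x\<^sup>2 / 2) x\<^sup>\<tau>\<close> is \<open>exp (- x\<^sup>2 / 2) x\<^sup>\<tau>\<^sup>-\<^sup>i \<Sum>l p\<^sub>i\<^sub>l(x) \<tau>\<^sup>l\<close> with these
  polynomials \<open>p\<^sub>i\<^sub>l\<close>; it matters that the sum is monic of degree \<open>i\<close> in \<open>\<tau>\<close>.\<close>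
primrec gauss_deriv_coeff :: "nat \<Rightarrow> nat \<Rightarrow> real poly" where
  "gauss_deriv_coeff 0 l = (if l = 0 then 1 else 0)"
| "gauss_deriv_coeff (Suc i) l = pCons 0 (pderiv (gauss_deriv_coeff i l)) - smult (of_nat i) (gauss_deriv_coeff i l)
     - [:0, 0, 1:] * gauss_deriv_coeff i l + (case l of 0 \<Rightarrow> 0 | Suc l' \<Rightarrow> gauss_deriv_coeff i l')"

lemma gauss_deriv_coeff_eq_0: "l > i \<Longrightarrow> gauss_deriv_coeff i l = 0"
  by (induction i arbitrary: l) (auto split: nat.splits)

lemma gauss_deriv_coeff_diag: "gauss_deriv_coeff i i = 1"
  by (induction i) (auto simp: gauss_deriv_coeff_eq_0)

definition gauss_deriv_poly :: "nat \<Rightarrow> real \<Rightarrow> real poly" where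
  "gauss_deriv_poly i x = (\<Sum>l\<le>i. monom (poly (gauss_deriv_coeff i l) x) l)"

lemma coeff_gauss_deriv_poly:
  "coeff (gauss_deriv_poly i x) l = (if l \<le> i then poly (gauss_deriv_coeff i l) x else 0)"
  by (simp add: gauss_deriv_poly_def coeff_sum)

lemma degree_gauss_deriv_poly: "degree (gauss_deriv_poly i x) \<le> i"
  by (rule degree_le) (simp add: coeff_gauss_deriv_poly)

lemma poly_gauss_deriv_poly:
  "poly (gauss_deriv_poly i x) \<tau> = (\<Sum>l\<le>i. \<tau> ^ l * poly (gauss_deriv_coeff i l) x)"
  by (simp add: gauss_deriv_poly_def poly_sum poly_monom mult.commute)

text \<open>The three terms of one differentiation in \<open>x\<close>, with a factor 1/x drawn out:
  the polynomial gives \<open>x\<close> times its derivative, the power of \<open>x\<close> gives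
  \<open>\<tau> - real i\<close>, the Gaussian gives \<open>- x\<^sup>2\<close>.\<close>

lemma gauss_deriv_poly_Suc:
  "poly (gauss_deriv_poly (Suc i) x) \<tau> =
     x * (\<Sum>l\<le>i. \<tau> ^ l * poly (pderiv (gauss_deriv_coeff i l)) x)
     + (\<tau> - real i - x\<^sup>2) * poly (gauss_deriv_poly i x) \<tau>"
proof -
  have "poly (gauss_deriv_poly (Suc i) x) \<tau> =
      (\<Sum>l\<le>Suc i. \<tau> ^ l * (x * poly (pderiv (gauss_deriv_coeff i l)) x
        - (real i + x\<^sup>2) * poly (gauss_deriv_coeff i l) x))
      + (\<Sum>l\<le>Suc i. \<tau> ^ l * poly (case l of 0 \<Rightarrow> 0 | Suc l' \<Rightarrow> gauss_deriv_coeff i l') x)"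
    unfolding poly_gauss_deriv_poly sum.distrib[symmetric]
    by (intro sum.cong refl) (simp add: algebra_simps power2_eq_square)
  also have "(\<Sum>l\<le>Suc i. \<tau> ^ l * poly (case l of 0 \<Rightarrow> 0 | Suc l' \<Rightarrow> gauss_deriv_coeff i l') x) =
      \<tau> * poly (gauss_deriv_poly i x) \<tau>"
    by (subst sum.atMost_Suc_shift) (simp add: poly_gauss_deriv_poly sum_distrib_left mult_ac)
  also have "(\<Sum>l\<le>Suc i. \<tau> ^ l * (x * poly (pderiv (gauss_deriv_coeff i l)) x
        - (real i + x\<^sup>2) * poly (gauss_deriv_coeff i l) x)) =
      x * (\<Sum>l\<le>i. \<tau> ^ l * poly (pderiv (gauss_deriv_coeff i l)) x)
      - (real i + x\<^sup>2) * poly (gauss_deriv_poly i x) \<tau>"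
    by (simp add: gauss_deriv_coeff_eq_0 poly_gauss_deriv_poly sum_distrib_left sum_subtractf algebra_simps)
  finally show ?thesis by (simp add: algebra_simps)
qed

lemma has_derivative_gauss_powr:
  assumes x: "x > 0"
  shows "((\<lambda>x. exp (- x\<^sup>2 / 2) * x powr (\<tau> - real i) * poly (gauss_deriv_poly i x) \<tau>) has_real_derivative
     exp (- x\<^sup>2 / 2) * x powr (\<tau> - real (Suc i)) * poly (gauss_deriv_poly (Suc i) x) \<tau>) (at x)"
proof -
  let ?S = "\<Sum>l\<le>i. \<tau> ^ l * poly (pderiv (gauss_deriv_coeff i l)) x"
  have "((\<lambda>x. poly (gauss_deriv_poly i x) \<tau>) has_real_derivative ?S) (at x)"
    unfolding poly_gauss_deriv_poly by (auto intro!: derivative_eq_intros poly_DERIV simp: mult.commute)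
  moreover have "((\<lambda>x. x powr (\<tau> - real i)) has_real_derivative (\<tau> - real i) * x powr (\<tau> - real (Suc i))) (at x)"
    using has_real_derivative_powr[OF x, of "\<tau> - real i"] by (simp add: algebra_simps)
  moreover have "((\<lambda>x. exp (- x\<^sup>2 / 2)) has_real_derivative - x * exp (- x\<^sup>2 / 2)) (at x)"
    by (auto intro!: derivative_eq_intros)
  ultimately have "((\<lambda>x. exp (- x\<^sup>2 / 2) * x powr (\<tau> - real i) * poly (gauss_deriv_poly i x) \<tau>) has_real_derivative
     (- x * exp (- x\<^sup>2 / 2) * x powr (\<tau> - real i)
       + (\<tau> - real i) * x powr (\<tau> - real (Suc i)) * exp (- x\<^sup>2 / 2)) * poly (gauss_deriv_poly i x) \<tau>
     + ?S * (exp (- x\<^sup>2 / 2) * x powr (\<tau> - real i))) (at x)"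
    by (intro DERIV_mult)
  moreover have "x powr (\<tau> - real i) = x powr (\<tau> - real (Suc i)) * x"
    using x powr_mult_base[of x "\<tau> - real (Suc i)"] by (simp add: algebra_simps)
  ultimately show ?thesis
    unfolding gauss_deriv_poly_Suc by (simp add: algebra_simps power2_eq_square)
qed

lemma funpow_deriv_gauss_powr:
  assumes f: "\<And>x. x > 0 \<Longrightarrow> f x = (\<Sum>k\<in>A. \<gamma> k * (exp (- x\<^sup>2 / 2) * x powr \<tau> k))"
    and x: "x > 0"
  shows "(deriv ^^ i) f x =
    (\<Sum>k\<in>A. \<gamma> k * (exp (- x\<^sup>2 / 2) * x powr (\<tau> k - real i) * poly (gauss_deriv_poly i x) (\<tau> k)))"
  using x
proof (induction i arbitrary: x)
  case 0
  then show ?case using f by (simp add: poly_gauss_deriv_poly)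
next
  case (Suc i)
  let ?g = "\<lambda>i x. \<Sum>k\<in>A. \<gamma> k * (exp (- x\<^sup>2 / 2) * x powr (\<tau> k - real i) * poly (gauss_deriv_poly i x) (\<tau> k))"
  have "(?g i has_real_derivative ?g (Suc i) x) (at x)"
    by (intro DERIV_sum DERIV_cmult has_derivative_gauss_powr Suc.prems)
  \<comment> \<open>The formula for the \<open>i\<close>-th derivative holds on the open half-line,
    which suffices to differentiate it at a point there.\<close>
  then have "((deriv ^^ i) f has_real_derivative ?g (Suc i) x) (at x)"
    by (rule has_field_derivative_transform_within_open[where S = "{0<..}"])
       (use Suc in auto)
  then show ?case by (simp add: DERIV_imp_deriv)
qed

lemma monic_laguerre_eq_lag_coeff:
  "monic_laguerre n b y = (\<Sum>k\<le>n. lag_coeff b n k * y ^ (n - k))"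
proof -
  have poch: "pochhammer (b + real (n - k) + 1) k = (\<Prod>i<k. real n + b - real i)" if "k \<le> n" for k
  proof -
    have "pochhammer (b + real (n - k) + 1) k = (\<Prod>i<k. b + real (n - k) + 1 + real i)"
      by (simp add: pochhammer_prod atLeast0LessThan)
    also have "\<dots> = (\<Prod>i<k. real n + b - real i)"
      using that by (intro prod.reindex_bij_witness[of _ "\<lambda>i. k - 1 - i" "\<lambda>i. k - 1 - i"]) (auto simp: of_nat_diff)
    finally show ?thesis .
  qed
  have "monic_laguerre n b y = (\<Sum>k\<le>n. (-1) ^ (n + (n - k)) * real (n choose (n - k)) *
      pochhammer (b + real (n - k) + 1) (n - (n - k)) * y ^ (n - k))"
    unfolding monic_laguerre_def
    by (rule sum.reindex_bij_witness[of _ "\<lambda>i. n - i" "\<lambda>i. n - i"]) auto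
  also have "\<dots> = (\<Sum>k\<le>n. lag_coeff b n k * y ^ (n - k))"
  proof (intro sum.cong refl, goal_cases)
    case (1 k)
    have "(-1 :: real) ^ (n + (n - k)) = (-1) ^ k"
      using 1 by (auto simp: minus_one_power_iff)
    then show ?case
      using 1 poch[of k] by (simp add: lag_coeff_def binomial_symmetric[of k n])
  qed
  finally show ?thesis .
qed

lemma power2_power_eq_powr:
  fixes x :: real
  assumes "x > 0"
  shows "(x\<^sup>2) ^ n = x powr (2 * real n)"
  using powr_realpow[OF assms, of "2 * n"] by (simp add: power_mult)

text \<open>In the first block \<open>col_exp\<close> contains \<open>b\<close>, and -b + 2b = b; in
  the second it does not. One exponent formula thus covers both blocks.\<close>

lemma psi_column:
  assumes x: "x > 0" and j: "j < length ms + length ns"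
  shows "((map (psi_plus b) ms @ map (psi_minus b) ns) ! j) x =
    (\<Sum>k\<le>col_deg ms ns j. col_coeff b ms ns j k *
       (exp (- x\<^sup>2 / 2) * x powr (1/2 - b + 2 * (col_exp b ms ns j - real k))))"
proof -
  have laguerre: "exp (- x\<^sup>2 / 2) * x powr (1/2 + s) * monic_laguerre n s (x\<^sup>2) =
      (\<Sum>k\<le>n. lag_coeff s n k * (exp (- x\<^sup>2 / 2) * x powr (1/2 + s + 2 * (real n - real k))))" for n s
  proof -
    have "x powr (1/2 + s) * (x\<^sup>2) ^ (n - k) = x powr (1/2 + s + 2 * (real n - real k))" if "k \<le> n" for k
    proof -
      have "(x\<^sup>2) ^ (n - k) = x powr (2 * (real n - real k))"
        using that by (simp add: power2_power_eq_powr[OF x] of_nat_diff)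
      then show ?thesis by (simp add: powr_add)
    qed
    then show ?thesis
      unfolding monic_laguerre_eq_lag_coeff sum_distrib_left by (intro sum.cong refl) (auto simp: mult_ac)
  qed
  have expo: "1/2 - b + 2 * (col_exp b ms ns j - real k) =
      1/2 + (if j < length ms then b else - b) + 2 * (real (col_deg ms ns j) - real k)" for k
    by (simp add: col_exp_def)
  have "((map (psi_plus b) ms @ map (psi_minus b) ns) ! j) x = exp (- x\<^sup>2 / 2) *
      x powr (1/2 + (if j < length ms then b else - b)) *
      monic_laguerre (col_deg ms ns j) (if j < length ms then b else - b) (x\<^sup>2)"
    using j by (auto simp: nth_append psi_plus_def psi_minus_def col_deg_def)
  then show ?thesis
    unfolding expo col_coeff_def laguerre .
qed

text \<open>The Gaussian derivatives are monic polynomials in the exponent of \<open>x\<close>,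
  which is \<open>1/2 - b\<close> plus twice the exponent of \<open>y\<close>. Two triangular row
  changes, the second contributing \<open>2 ^ i\<close>, reduce the rows to powers; then the common
  factors \<open>w j\<close> leave the columns.\<close>

lemma Psi_eq_wr_det:
  assumes x: "x > 0" and N: "N = length ms + length ns"
  shows "Psi b ms ns x = (\<Prod>i<N. 2 ^ i) * exp (- real N / 2 * x\<^sup>2) *
    x powr (real N * (1/2 - b) + 2 * b * real (length ms) - (\<Sum>i<N. real i)) * wr_det b ms ns (x\<^sup>2)"
proof -
  let ?e = "col_deg ms ns" and ?a = "\<lambda>j k. col_exp b ms ns j - real k"
  let ?\<tau> = "\<lambda>j k. 1/2 - b + 2 * ?a j k"
  define \<gamma> where "\<gamma> j k = col_coeff b ms ns j k * (exp (- x\<^sup>2 / 2) * x powr ?\<tau> j k)" for j k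
  define w where "w j = exp (- x\<^sup>2 / 2) * x powr (1/2 - b + (if j < length ms then 2 * b else 0))" for j
  let ?p = "\<lambda>i. smult (x powr (- real i)) (gauss_deriv_poly i x)"
  have shift: "x powr (t - real i) = x powr t * x powr (- real i)" for t i
    by (simp add: powr_add[symmetric])
  have "Psi b ms ns x = det (mat N N (\<lambda>(i,j). \<Sum>k\<le>?e j. \<gamma> j k * poly (?p i) (?\<tau> j k)))"
    unfolding Psi_def wronskian_def
  proof (rule arg_cong[of _ _ det], rule eq_matI, goal_cases)
    case (1 i j)
    then have "(deriv ^^ i) ((map (psi_plus b) ms @ map (psi_minus b) ns) ! j) x =
        (\<Sum>k\<le>?e j. col_coeff b ms ns j k * (exp (- x\<^sup>2 / 2) * x powr (?\<tau> j k - real i) *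
           poly (gauss_deriv_poly i x) (?\<tau> j k)))"
      using psi_column[of _ j ms ns b] N by (intro funpow_deriv_gauss_powr x) auto
    also have "\<dots> = (\<Sum>k\<le>?e j. \<gamma> j k * poly (?p i) (?\<tau> j k))"
      unfolding shift \<gamma>_def by (intro sum.cong refl) (simp only: poly_smult mult_ac)
    finally show ?case using 1 N by simp
  qed (use N in auto)
  also have "\<dots> = (\<Prod>i<N. x powr (- real i)) * det (mat N N (\<lambda>(i,j). \<Sum>k\<le>?e j. \<gamma> j k * ?\<tau> j k ^ i))"
    by (subst det_change_polynomial_basis)
       (auto simp: degree_gauss_deriv_poly coeff_gauss_deriv_poly gauss_deriv_coeff_diag)
  also have "det (mat N N (\<lambda>(i,j). \<Sum>k\<le>?e j. \<gamma> j k * ?\<tau> j k ^ i)) =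
      det (mat N N (\<lambda>(i,j). \<Sum>k\<le>?e j. \<gamma> j k * poly ([:1/2 - b, 2:] ^ i) (?a j k)))"
    by (simp add: poly_power mult.commute)
  also have "\<dots> = (\<Prod>i<N. 2 ^ i) * det (mat N N (\<lambda>(i,j). \<Sum>k\<le>?e j. \<gamma> j k * ?a j k ^ i))"
  proof -
    have "degree ([:1/2 - b, 2:] ^ i) = i" for i
      by (simp add: degree_power_eq)
    moreover from this have "coeff ([:1/2 - b, 2:] ^ i) i = 2 ^ i" for i
      using lead_coeff_power[of "[:1/2 - b, 2:]" i] by simp
    ultimately show ?thesis by (subst det_change_polynomial_basis) auto
  qed
  also have "det (mat N N (\<lambda>(i,j). \<Sum>k\<le>?e j. \<gamma> j k * ?a j k ^ i)) = wr_det b ms ns (x\<^sup>2) * (\<Prod>j<N. w j)"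
  proof -
    have "\<gamma> j k = col_coeff b ms ns j k * (x\<^sup>2) ^ (?e j - k) * w j" if "k \<le> ?e j" for j k
    proof -
      have "(x\<^sup>2) ^ (?e j - k) = x powr (2 * (real (?e j) - real k))"
        using that by (simp add: power2_power_eq_powr[OF x] of_nat_diff)
      then show ?thesis
        by (auto simp: \<gamma>_def w_def col_exp_def powr_add[symmetric] algebra_simps)
    qed
    then have "(\<Sum>k\<le>?e j. \<gamma> j k * ?a j k ^ i) =
        (\<Sum>k\<le>?e j. col_coeff b ms ns j k * (x\<^sup>2) ^ (?e j - k) * ?a j k ^ i) * w j" for i j
      unfolding sum_distrib_right by (intro sum.cong refl) auto
    then show ?thesis
      unfolding wr_det_def Let_def N[symmetric] by (simp only: det_scale_columns)
  qed
  also have "(\<Prod>i<N. x powr (- real i)) = x powr (- (\<Sum>i<N. real i))"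
    using x by (simp add: powr_sum sum_negf[symmetric])
  also have "(\<Prod>j<N. w j) = exp (- real N / 2 * x\<^sup>2) * x powr (real N * (1/2 - b) + 2 * b * real (length ms))"
  proof -
    have "(\<Sum>j<N. if j < length ms then 2 * b else 0) = 2 * b * real (length ms)"
    proof -
      have "{..<N} \<inter> {j. j < length ms} = {..<length ms}" using N by auto
      then show ?thesis by (simp add: sum.If_cases)
    qed
    moreover have "(\<Prod>j<N. exp (- x\<^sup>2 / 2)) = exp (- real N / 2 * x\<^sup>2)"
      by (simp add: exp_of_nat_mult[symmetric])
    moreover have "(\<Prod>j<N. x powr (1/2 - b + (if j < length ms then 2 * b else 0))) =
        x powr (\<Sum>j<N. 1/2 - b + (if j < length ms then 2 * b else 0))"
      using x by (simp add: powr_sum)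
    ultimately show ?thesis
      unfolding w_def prod.distrib sum.distrib by simp
  qed
  finally show ?thesis
    by (simp add: powr_add[symmetric] mult_ac)
qed

section \<open>Uniqueness\<close>

lemma poly_eq_if_infinite:
  fixes p q :: "'a :: idom poly"
  assumes "infinite A" "\<And>x. x \<in> A \<Longrightarrow> poly p x = poly q x"
  shows "p = q"
proof (rule ccontr)
  assume "p \<noteq> q"
  then have "finite {x. poly (p - q) x = 0}" by (intro poly_roots_finite) simp
  moreover have "A \<subseteq> {x. poly (p - q) x = 0}" using assms(2) by auto
  ultimately show False using assms(1) finite_subset by blast
qed

text \<open>Agreement for all positive \<open>y\<close> fixes the polynomial in \<open>y\<close>;
  agreement for \<open>b\<close> in the unit interval then fixes each coefficient as a polynomial in
  \<open>b\<close>. That interval contains no integer, so Vandermonde factors can be cancelled on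
  it.\<close>

lemma eval_beta_shift_eq:
  assumes "\<And>b y. 0 < b \<Longrightarrow> b < 1 \<Longrightarrow> y > 0 \<Longrightarrow>
    poly (eval_beta P b) y = poly (eval_beta P' (b + c)) y"
  shows "eval_beta P b = eval_beta P' (b + c)"
proof (rule poly_eqI)
  fix i
  have "eval_beta P b = eval_beta P' (b + c)" if "b \<in> {0<..<1}" for b
    by (rule poly_eq_if_infinite[of "{0<..}"]) (use assms that infinite_Ioi in auto)
  then have "coeff (eval_beta P b) i = coeff (eval_beta P' (b + c)) i" if "b \<in> {0<..<1}" for b
    using that by simp
  then have "map_poly of_int (coeff P i) = pcompose (map_poly of_int (coeff P' i)) [:c, 1 :: real:]"
    by (intro poly_eq_if_infinite[of "{0<..<1}"])
       (auto simp: infinite_Ioo eval_beta_def coeff_map_poly poly_pcompose add.commute)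
  then have "poly (map_poly of_int (coeff P i)) b = poly (pcompose (map_poly of_int (coeff P' i)) [:c, 1:]) b"
    by simp
  then show "coeff (eval_beta P b) i = coeff (eval_beta P' (b + c)) i"
    by (simp add: eval_beta_def coeff_map_poly poly_pcompose add.commute)
qed

lemma eval_beta_inj:
  assumes "\<And>b. eval_beta P b = eval_beta P' b"
  shows "P = P'"
proof (rule poly_eqI)
  fix i
  have "poly (map_poly of_int (coeff P i)) b = poly (map_poly of_int (coeff P' i)) b" for b :: real
    using arg_cong[OF assms[of b], of "\<lambda>p. coeff p i"] by (simp add: eval_beta_def coeff_map_poly)
  then have "map_poly of_int (coeff P i) = (map_poly of_int (coeff P' i) :: real poly)"
    by (intro poly_eq_if_infinite[OF infinite_UNIV_char_0])
  then have "of_int (coeff (coeff P i) k) = (of_int (coeff (coeff P' i) k) :: real)" for k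
    by (metis coeff_map_poly of_int_0)
  then show "coeff P i = coeff P' i"
    by (intro poly_eqI) simp
qed

lemma real_tri: "real (tri n) = real n * (real n - 1) / 2"
  unfolding tri_def by (induction n) (auto simp: field_simps)

text \<open>Entries of both kinds are \<open>2 * col_exp b ms ns j - b\<close>; the shift drops out
  of the differences, and each difference contributes a factor 2.\<close>

lemma kappa_eq:
  assumes N: "N = length ms + length ns"
  shows "kappa b ms ns = (\<Prod>i<N. 2 ^ i) * vandermonde_prod N (col_exp b ms ns)"
proof -
  let ?v = "map (\<lambda>m. 2 * real m + b) ms @ map (\<lambda>n. 2 * real n - b) ns"
  have "?v ! j = 2 * col_exp b ms ns j - b" if "j < N" for j
    using that N by (auto simp: nth_append col_exp_def col_deg_def)
  note v = this
  have "(\<Prod>i<j. ?v ! j - ?v ! i) = (\<Prod>i<j. 2 * (col_exp b ms ns j - col_exp b ms ns i))" if "j < N" for j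
  proof (intro prod.cong refl)
    fix i assume "i \<in> {..<j}"
    with that v[of i] v[of j] show "?v ! j - ?v ! i = 2 * (col_exp b ms ns j - col_exp b ms ns i)" by simp
  qed
  then have "(\<Prod>i<j. ?v ! j - ?v ! i) = 2 ^ j * (\<Prod>i<j. col_exp b ms ns j - col_exp b ms ns i)" if "j < N" for j
    using that by (simp only: prod.distrib prod_constant card_lessThan)
  then show ?thesis
    using N by (simp add: kappa_def vandermonde_def vandermonde_prod_def prod.distrib)
qed

lemma vandermonde_col_exp_nonzero:
  fixes b :: real
  assumes "b \<notin> \<int>" "distinct ms" "distinct ns" "N = length ms + length ns"
  shows "vandermonde_prod N (col_exp b ms ns) \<noteq> 0"
proof (rule vandermonde_prod_nonzero)
  fix i j assume ij: "i < j" "j < N"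
  have "real m + b \<noteq> real n" for m n
  proof
    assume "real m + b = real n"
    then have "b = of_int (int n - int m)" by simp
    with assms(1) show False by (metis Ints_of_int)
  qed
  with ij assms show "col_exp b ms ns i \<noteq> col_exp b ms ns j"
    by (auto simp: col_exp_def col_deg_def nth_append nth_eq_iff_index_eq)
qed

lemma Ioo_0_1_not_Ints:
  fixes b :: real
  assumes "0 < b" "b < 1"
  shows "b \<notin> \<int>"
  using assms by (auto elim!: Ints_cases)

lemma Psi_factorization:
  assumes N: "N = length ms + length ns"
    and fact: "\<And>b y. wr_det b ms ns y =
       vandermonde_prod N (col_exp b ms ns) * y ^ (tri (length ms) + tri (length ns)) * g b y"
    and x: "x > 0"
  shows "Psi b ms ns x = kappa b ms ns * exp (- (real (length ms) + real (length ns)) / 2 * x\<^sup>2)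
          * x powr ((real (length ms) - real (length ns))\<^sup>2 / 2 + b * (real (length ms) - real (length ns)))
          * g b (x\<^sup>2)"
proof -
  let ?r = "real (length ms)" and ?s = "real (length ns)"
  have "(\<Sum>i<N. real i) = real (tri N)" by (simp add: tri_def)
  then have "(\<Sum>i<N. real i) = (?r + ?s) * (?r + ?s - 1) / 2" by (simp add: real_tri N)
  \<comment> \<open>The exponent from \<open>Psi_eq_wr_det\<close> and the split-off power of
    \<open>y\<close>, taken at the square of \<open>x\<close>, combine to the exponent required by
    \<open>PhiT\<close>.\<close>
  then have "real N * (1/2 - b) + 2 * b * ?r - (\<Sum>i<N. real i) + 2 * real (tri (length ms) + tri (length ns)) =
      (?r - ?s)\<^sup>2 / 2 + b * (?r - ?s)"
    by (simp add: N real_tri power2_eq_square field_simps)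
  then have "x powr (real N * (1/2 - b) + 2 * b * ?r - (\<Sum>i<N. real i)) * (x\<^sup>2) ^ (tri (length ms) + tri (length ns)) =
      x powr ((?r - ?s)\<^sup>2 / 2 + b * (?r - ?s))"
    unfolding power2_power_eq_powr[OF x] powr_add[symmetric] by simp
  note exponent = this
  have "Psi b ms ns x = (\<Prod>i<N. 2 ^ i) * vandermonde_prod N (col_exp b ms ns) * exp (- real N / 2 * x\<^sup>2) *
      (x powr (real N * (1/2 - b) + 2 * b * ?r - (\<Sum>i<N. real i)) * (x\<^sup>2) ^ (tri (length ms) + tri (length ns))) *
      g b (x\<^sup>2)"
    unfolding Psi_eq_wr_det[OF x N] fact by (simp only: mult_ac)
  then show ?thesis
    unfolding exponent kappa_eq[OF N] by (simp add: N)
qed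

text \<open>The monic polynomial of the factorization has the defining property of
  \<open>PhiT\<close>. Uniqueness holds because \<open>kappa\<close> is nonzero for \<open>b\<close>
  in the open unit interval and can be cancelled there.\<close>

lemma wr_det_eq_PhiT:
  assumes "distinct ms" "distinct ns" and N: "N = length ms + length ns"
  shows "wr_det b ms ns y =
    vandermonde_prod N (col_exp b ms ns) * y ^ (tri (length ms) + tri (length ns)) * PhiT_eval b ms ns y"
proof -
  obtain P :: "int poly poly" where P: "lead_coeff P = 1" and fact: "\<And>b y. wr_det b ms ns y =
       vandermonde_prod N (col_exp b ms ns) * y ^ (tri (length ms) + tri (length ns)) * poly (eval_beta P b) y"
    using wr_det_factorization[OF assms] by blast
  note Psi_P = Psi_factorization[OF N, of "\<lambda>b y. poly (eval_beta P b) y", OF fact]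
  have "PhiT ms ns = P"
    unfolding PhiT_def
  proof (rule the_equality)
    fix P' :: "int poly poly"
    assume P': "lead_coeff P' = 1 \<and> (\<forall>b x. x > 0 \<longrightarrow>
        Psi b ms ns x = kappa b ms ns * exp (- (real (length ms) + real (length ns)) / 2 * x\<^sup>2)
          * x powr ((real (length ms) - real (length ns))\<^sup>2 / 2 + b * (real (length ms) - real (length ns)))
          * poly (eval_beta P' b) (x\<^sup>2))"
    have "poly (eval_beta P' b) y = poly (eval_beta P (b + 0)) y" if b: "0 < b" "b < 1" and y: "y > 0" for b y
    proof -
      have "vandermonde_prod N (col_exp b ms ns) \<noteq> 0"
        using vandermonde_col_exp_nonzero[OF Ioo_0_1_not_Ints[OF b] assms] .
      then have "kappa b ms ns \<noteq> 0" by (simp add: kappa_eq[OF N])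
      moreover have "sqrt y > 0" "(sqrt y)\<^sup>2 = y" using y by auto
      ultimately show ?thesis
        using Psi_P[of "sqrt y" b] P'[THEN conjunct2, rule_format, of "sqrt y" b] by simp
    qed
    then have "eval_beta P' b = eval_beta P (b + 0)" for b
      by (rule eval_beta_shift_eq)
    then show "P' = P" by (intro eval_beta_inj) simp
  qed (use P Psi_P in auto)
  then show ?thesis by (simp add: PhiT_eval_def fact)
qed

section \<open>Appending a degree\<close>

text \<open>An integer shift \<open>c\<close> keeps \<open>b + c\<close> away from the integers, so
  the common factor can be cancelled for \<open>b\<close> in the unit interval; the polynomial
  identity then extends to all \<open>b\<close> and \<open>y\<close>.\<close>

lemma PhiT_eval_shift:
  assumes "distinct ms" "distinct ns" "distinct ms'" "distinct ns'"
    and N: "N = length ms + length ns" and N': "N' = length ms' + length ns'"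
    and c: "c \<in> \<int>"
    and tri: "tri (length ms') + tri (length ns') = d + (tri (length ms) + tri (length ns))"
    and wr: "\<And>b y. wr_det (b + c) ms' ns' y = G b * y ^ d * wr_det b ms ns y"
    and V: "\<And>b. vandermonde_prod N' (col_exp (b + c) ms' ns') = G b * vandermonde_prod N (col_exp b ms ns)"
  shows "PhiT_eval b ms ns y = PhiT_eval (b + c) ms' ns' y"
proof -
  have "PhiT_eval b ms ns y = PhiT_eval (b + c) ms' ns' y" if b: "0 < b" "b < 1" and y: "y > 0" for b y
  proof -
    have "b + c \<notin> \<int>"
      using Ioo_0_1_not_Ints[OF b] c Ints_diff[of "b + c" c] by auto
    then have "vandermonde_prod N' (col_exp (b + c) ms' ns') \<noteq> 0"
      by (rule vandermonde_col_exp_nonzero) (use assms in auto)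
    moreover have "vandermonde_prod N' (col_exp (b + c) ms' ns') * y ^ (tri (length ms') + tri (length ns')) *
        PhiT_eval (b + c) ms' ns' y =
      vandermonde_prod N' (col_exp (b + c) ms' ns') * y ^ (tri (length ms') + tri (length ns')) * PhiT_eval b ms ns y"
      using wr[of b y] unfolding wr_det_eq_PhiT[OF assms(3,4) N'] wr_det_eq_PhiT[OF assms(1,2) N] tri V
      by (simp add: power_add mult_ac)
    ultimately show ?thesis using y by simp
  qed
  then show ?thesis
    unfolding PhiT_eval_def using eval_beta_shift_eq[of "PhiT ms ns" "PhiT ms' ns'" c b] by simp
qed

text \<open>In the row basis 1, x - c, (x - c)(x - d), (x - c)(x - d)^2, ... column
  \<open>p\<close>, concentrated at the node c, has a 1 in the first row and zeros below. Laplace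
  expansion leaves the other columns, multiplied by x - c, while d realigns their exponents.\<close>

lemma det_power_sums_remove_column:
  fixes \<gamma> \<tau> :: "nat \<Rightarrow> 'b \<Rightarrow> 'a :: comm_ring_1"
  assumes p: "p \<le> N"
    and col: "\<And>g. (\<Sum>k\<in>S p. \<gamma> p k * g (\<tau> p k)) = g c"
    and others: "\<And>l j. j < N \<Longrightarrow> (\<Sum>k\<in>S (insert_index p j). \<gamma> (insert_index p j) k *
      ((\<tau> (insert_index p j) k - c) * (\<tau> (insert_index p j) k - d) ^ l)) = w j * B l j"
  shows "det (mat (Suc N) (Suc N) (\<lambda>(l,j). \<Sum>k\<in>S j. \<gamma> j k * \<tau> j k ^ l)) =
    (-1) ^ p * (\<Prod>j<N. w j) * det (mat N N (\<lambda>(l,j). B l j))"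
proof -
  define q where "q l = (case l of 0 \<Rightarrow> 1 | Suc l' \<Rightarrow> [:- c, 1:] * [:- d, 1:] ^ l')" for l
  have poly_q: "poly (q (Suc l)) x = (x - c) * (x - d) ^ l" for l x
    by (simp add: q_def poly_power algebra_simps)
  have deg: "degree ([:- d, 1:] ^ l) \<le> l" for l
    using degree_power_le[of "[:- d, 1:]" l] degree_pCons_le[of "- d" "[:1:]"]
    by (simp add: mult_le_mono1 order.trans)
  have lead: "coeff ([:- d, 1:] ^ l) l = 1" for l
    by (induction l) (use deg in \<open>auto simp: coeff_eq_0 le_imp_less_Suc\<close>)
  have "degree (q l) \<le> l \<and> coeff (q l) l = 1" for l
  proof (cases l)
    case (Suc l')
    have "degree ([:- c, 1:] * [:- d, 1:] ^ l') \<le> 1 + l'"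
      using degree_mult_le[of "[:- c, 1:]" "[:- d, 1:] ^ l'"] deg[of l'] degree_pCons_le[of "- c" "[:1:]"]
      by simp
    moreover have "coeff ([:- d, 1:] ^ l') (Suc l') = 0"
      using deg[of l'] by (intro coeff_eq_0) auto
    ultimately show ?thesis using lead[of l'] Suc by (simp add: q_def)
  qed (simp add: q_def)
  then have "det (mat (Suc N) (Suc N) (\<lambda>(l,j). \<Sum>k\<in>S j. \<gamma> j k * \<tau> j k ^ l)) =
      det (mat (Suc N) (Suc N) (\<lambda>(l,j). \<Sum>k\<in>S j. \<gamma> j k * poly (q l) (\<tau> j k)))" (is "_ = det ?A")
    by (subst det_change_polynomial_basis) auto
  also have "\<dots> = (\<Sum>l<Suc N. ?A $$ (l, p) * cofactor ?A l p)"
    using p by (intro laplace_expansion_column) auto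
  also have "\<dots> = (\<Sum>l<Suc N. if l = 0 then cofactor ?A 0 p else 0)"
    using p col by (intro sum.cong refl) (auto simp: q_def poly_power split: nat.splits)
  also have "\<dots> = (-1) ^ p * det (mat_delete ?A 0 p)"
    by (simp add: cofactor_def)
  also have "mat_delete ?A 0 p = mat N N (\<lambda>(l,j). B l j * w j)"
  proof (rule eq_matI, goal_cases)
    case (1 l j)
    then show ?case
      using others[of j l] by (auto simp: mat_delete_def insert_index_def poly_q mult.commute)
  qed auto
  also have "det \<dots> = det (mat N N (\<lambda>(l,j). B l j)) * (\<Prod>j<N. w j)"
    by (rule det_scale_columns)
  finally show ?thesis by (simp add: mult_ac)
qed

text \<open>Coefficient form of a derivative rule: the monic Laguerre polynomial of degree e + 1 and
  parameter s - 1 has as derivative e + 1 times that of degree e and parameter s.\<close>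

lemma lag_coeff_Suc_degree:
  "(of_nat (Suc e) - of_nat k) * lag_coeff (s - 1) (Suc e) k = of_nat (Suc e) * lag_coeff s e k"
proof (cases "k \<le> Suc e")
  case True
  have "(Suc e - k) * (Suc e choose k) = Suc e * (e choose k)"
    using binomial_absorb_comp[of "Suc e" k] by simp
  then have "of_nat (Suc e - k) * of_nat (Suc e choose k) = (of_nat (Suc e) * of_nat (e choose k) :: 'a)"
    by (metis of_nat_mult)
  then have "(of_nat (Suc e) - of_nat k) * of_nat (Suc e choose k) = (of_nat (Suc e) * of_nat (e choose k) :: 'a)"
    using True by (simp add: of_nat_diff)
  then have "(-1) ^ k * ((of_nat (Suc e) - of_nat k) * of_nat (Suc e choose k)) * (\<Prod>i<k. of_nat e + s - of_nat i) =
      (-1) ^ k * (of_nat (Suc e) * of_nat (e choose k)) * (\<Prod>i<k. of_nat e + s - of_nat i)"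
    by (rule arg_cong)
  moreover have "(\<Prod>i<k. of_nat (Suc e) + (s - 1) - of_nat i) = (\<Prod>i<k. of_nat e + s - of_nat i)"
    by (simp add: algebra_simps)
  ultimately show ?thesis
    unfolding lag_coeff_def by (simp only: mult_ac)
qed (simp add: lag_coeff_eq_0)

text \<open>Coefficient form of a derivative rule: y^s times the polynomial with parameter s has as
  derivative (e + s) y^(s-1) times the polynomial of the same degree with parameter s - 1.\<close>

lemma lag_coeff_shift_parameter:
  "(of_nat e + s - of_nat k) * lag_coeff s e k = (of_nat e + s) * lag_coeff (s - 1) e k"
proof -
  have "(\<Prod>i<k. of_nat e + s - of_nat i) * (of_nat e + s - of_nat k) = (\<Prod>i<Suc k. of_nat e + s - of_nat i)"
    by simp
  also have "\<dots> = (of_nat e + s) * (\<Prod>i<k. of_nat e + (s - 1) - of_nat i)"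
    by (subst prod.lessThan_Suc_shift) (simp add: algebra_simps)
  finally have "(-1) ^ k * of_nat (e choose k) * ((\<Prod>i<k. of_nat e + s - of_nat i) * (of_nat e + s - of_nat k)) =
      (-1) ^ k * of_nat (e choose k) * ((of_nat e + s) * (\<Prod>i<k. of_nat e + (s - 1) - of_nat i))"
    by (rule arg_cong)
  then show ?thesis
    unfolding lag_coeff_def by (simp only: mult_ac)
qed

lemma lag_column_Suc_degree:
  fixes s y :: "'a :: comm_ring_1"
  shows "(\<Sum>k\<le>Suc e. lag_coeff (s - 1) (Suc e) k * y ^ (Suc e - k) * ((of_nat (Suc e) - of_nat k) * g k)) =
    of_nat (Suc e) * y * (\<Sum>k\<le>e. lag_coeff s e k * y ^ (e - k) * g k)"
proof -
  have "(\<Sum>k\<le>Suc e. lag_coeff (s - 1) (Suc e) k * y ^ (Suc e - k) * ((of_nat (Suc e) - of_nat k) * g k)) =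
      (\<Sum>k\<le>Suc e. ((of_nat (Suc e) - of_nat k) * lag_coeff (s - 1) (Suc e) k) * (y ^ (Suc e - k) * g k))"
    by (simp only: mult_ac)
  also have "\<dots> = (\<Sum>k\<le>e. of_nat (Suc e) * lag_coeff s e k * (y ^ (Suc e - k) * g k))"
    unfolding lag_coeff_Suc_degree by (simp add: lag_coeff_eq_0)
  also have "\<dots> = of_nat (Suc e) * y * (\<Sum>k\<le>e. lag_coeff s e k * y ^ (e - k) * g k)"
    unfolding sum_distrib_left by (intro sum.cong refl) (simp add: Suc_diff_le mult_ac)
  finally show ?thesis .
qed

lemma lag_column_shift_parameter:
  fixes s y :: "'a :: comm_ring_1"
  shows "(\<Sum>k\<le>e. lag_coeff s e k * y ^ (e - k) * ((of_nat e + s - of_nat k) * g k)) =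
    (of_nat e + s) * (\<Sum>k\<le>e. lag_coeff (s - 1) e k * y ^ (e - k) * g k)"
proof -
  have "(\<Sum>k\<le>e. lag_coeff s e k * y ^ (e - k) * ((of_nat e + s - of_nat k) * g k)) =
      (\<Sum>k\<le>e. ((of_nat e + s - of_nat k) * lag_coeff s e k) * (y ^ (e - k) * g k))"
    by (simp only: mult_ac)
  then show ?thesis
    unfolding lag_coeff_shift_parameter by (simp only: sum_distrib_left mult_ac)
qed

text \<open>In \<open>col\<close>, the Euler operator minus the exponent of the removed column acts
  on a remaining column; the weight \<open>g\<close> is free so that it can carry the further row
  powers.\<close>

lemma wr_det_remove_column:
  fixes b b' :: "'a :: comm_ring_1"
  assumes N: "N = length ms + length ns" and N': "length ms' + length ns' = Suc N" and p: "p \<le> N"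
    and deg: "col_deg ms' ns' p = 0"
    and exp: "\<And>j. j < N \<Longrightarrow> col_exp b' ms' ns' (insert_index p j) = col_exp b ms ns j + d"
    and col: "\<And>j g. j < N \<Longrightarrow>
      (\<Sum>k\<le>col_deg ms' ns' (insert_index p j). col_coeff b' ms' ns' (insert_index p j) k *
         y ^ (col_deg ms' ns' (insert_index p j) - k) *
         ((col_exp b' ms' ns' (insert_index p j) - of_nat k - col_exp b' ms' ns' p) * g k)) =
      w j * (\<Sum>k\<le>col_deg ms ns j. col_coeff b ms ns j k * y ^ (col_deg ms ns j - k) * g k)"
  shows "wr_det b' ms' ns' y = (-1) ^ p * (\<Prod>j<N. w j) * wr_det b ms ns y"
  unfolding wr_det_def Let_def N' N[symmetric]
proof (rule det_power_sums_remove_column[OF p, where c = "col_exp b' ms' ns' p" and d = d], goal_cases)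
  case (1 g)
  show ?case using deg by (simp add: col_coeff_def)
next
  case (2 l j)
  have "col_exp b' ms' ns' (insert_index p j) - of_nat k - d = col_exp b ms ns j - of_nat k" for k
    using exp[OF 2] by simp
  then show ?case using col[OF 2, of "\<lambda>k. (col_exp b ms ns j - of_nat k) ^ l"] by (simp only:)
qed

text \<open>The same reduction for single-term columns. Its constant agrees with that for
  \<open>wr_det\<close> up to a power of \<open>y\<close>, so the two cancel.\<close>

lemma vandermonde_remove_column:
  fixes a a' :: "nat \<Rightarrow> 'a :: comm_ring_1"
  assumes p: "p \<le> N" and a: "\<And>j. j < N \<Longrightarrow> a' (insert_index p j) = a j + d"
  shows "vandermonde_prod (Suc N) a' = (-1) ^ p * (\<Prod>j<N. a j + d - a' p) * vandermonde_prod N a"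
  using det_power_sums_remove_column[where N = N and p = p and S = "\<lambda>_. {()}" and \<gamma> = "\<lambda>_ _. 1"
      and \<tau> = "\<lambda>j _. a' j" and c = "a' p" and d = d and w = "\<lambda>j. a j + d - a' p" and B = "\<lambda>l j. a j ^ l"]
    p a by (simp add: det_vandermonde)

text \<open>The new column is \<open>y\<close> to the power \<open>b - 1\<close>. The Euler operator
  minus \<open>b - 1\<close> lowers the degree and raises the parameter to \<open>b\<close> in the
  first block, and takes the parameter from \<open>1 - b\<close> to \<open>- b\<close> in the
  second. Leading exponents agree, so \<open>d = 0\<close>.\<close>

lemma PhiT_eval_append_plus:
  assumes "distinct ms" "distinct ns"
  shows "PhiT_eval b ms ns y = PhiT_eval (b - 1) (map Suc ms @ [0]) ns y"
proof -
  let ?r = "length ms" and ?ms' = "map Suc ms @ [0]"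
  define N where "N = ?r + length ns"
  define u where "u b j = col_exp b ms ns j - (b - 1)" for b :: real and j
  have p: "?r \<le> N" by (simp add: N_def)
  have deg: "col_deg ?ms' ns (insert_index ?r j) = (if j < ?r then Suc (col_deg ms ns j) else col_deg ms ns j)" for j
    by (auto simp: col_deg_def nth_append insert_index_def Suc_diff_le)
  have less: "insert_index ?r j < length ?ms' \<longleftrightarrow> j < ?r" for j
    by (auto simp: insert_index_def)
  have deg_p: "col_deg ?ms' ns ?r = 0" by (simp add: col_deg_def nth_append)
  have exp_p: "col_exp (b - 1) ?ms' ns ?r = b - 1" for b :: real by (simp add: col_exp_def deg_p)
  have exp: "col_exp (b - 1) ?ms' ns (insert_index ?r j) = col_exp b ms ns j" for b :: real and j
    unfolding col_exp_def deg less by auto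
  have "wr_det (b - 1) ?ms' ns y = (-1) ^ ?r * (\<Prod>j<N. (if j < ?r then y else 1) * u b j) * wr_det b ms ns y"
    for b y :: real
  proof (rule wr_det_remove_column[where d = 0])
    fix j g assume "j < N"
    show "(\<Sum>k\<le>col_deg ?ms' ns (insert_index ?r j). col_coeff (b - 1) ?ms' ns (insert_index ?r j) k *
         y ^ (col_deg ?ms' ns (insert_index ?r j) - k) *
         ((col_exp (b - 1) ?ms' ns (insert_index ?r j) - of_nat k - col_exp (b - 1) ?ms' ns ?r) * g k)) =
      (if j < ?r then y else 1) * u b j *
      (\<Sum>k\<le>col_deg ms ns j. col_coeff b ms ns j k * y ^ (col_deg ms ns j - k) * g k)"
    proof (cases "j < ?r")
      case True
      then show ?thesis
        using lag_column_Suc_degree[of b "col_deg ms ns j" y g]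
        unfolding exp exp_p u_def col_coeff_def deg less
        by (simp add: col_exp_def algebra_simps)
    next
      case False
      then show ?thesis
        using lag_column_shift_parameter[of "1 - b" "col_deg ms ns j" y g]
        unfolding exp exp_p u_def col_coeff_def deg less
        by (simp add: col_exp_def algebra_simps)
    qed
  qed (use p deg_p exp in \<open>auto simp: N_def\<close>)
  moreover have "(\<Prod>j<N. (if j < ?r then y else 1) * u b j) = y ^ ?r * (\<Prod>j<N. u b j)" for b y :: real
  proof -
    have "{..<N} \<inter> {j. j < ?r} = {..<?r}" using p by auto
    then show ?thesis by (simp add: prod.distrib prod.If_cases)
  qed
  ultimately have wr: "wr_det (b + -1) ?ms' ns y = ((-1) ^ ?r * (\<Prod>j<N. u b j)) * y ^ ?r * wr_det b ms ns y"
    for b y :: real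
    by (simp add: mult_ac)
  have V: "vandermonde_prod (Suc N) (col_exp (b + -1) ?ms' ns) =
      ((-1) ^ ?r * (\<Prod>j<N. u b j)) * vandermonde_prod N (col_exp b ms ns)" for b :: real
    using vandermonde_remove_column[OF p, of "col_exp (b - 1) ?ms' ns" "col_exp b ms ns" 0] exp[of b] exp_p[of b]
    by (simp add: u_def)
  have "PhiT_eval b ms ns y = PhiT_eval (b + -1) ?ms' ns y"
    by (rule PhiT_eval_shift[OF assms _ _ N_def _ _ _ wr V]) (use assms in \<open>auto simp: distinct_map tri_def N_def\<close>)
  then show ?thesis by simp
qed

text \<open>The new column is the constant 1, annihilated by the Euler operator itself. The blocks
  exchange roles: the first passes from parameter \<open>b + 1\<close> to \<open>b\<close>, the
  second drops in degree. Leading exponents exceed those of the smaller determinant by one, hence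
  \<open>d = 1\<close>.\<close>

lemma PhiT_eval_append_minus:
  assumes "distinct ms" "distinct ns"
  shows "PhiT_eval b ms ns y = PhiT_eval (b + 1) ms (map Suc ns @ [0]) y"
proof -
  let ?r = "length ms" and ?s = "length ns" and ?ns' = "map Suc ns @ [0]"
  define N where "N = ?r + ?s"
  define u where "u b j = col_exp b ms ns j + 1" for b :: real and j
  have deg: "col_deg ms ?ns' (insert_index N j) = (if j < ?r then col_deg ms ns j else Suc (col_deg ms ns j))" if "j < N" for j
    using that by (auto simp: col_deg_def nth_append N_def)
  have less: "insert_index N j = j" if "j < N" for j
    using that by simp
  have deg_p: "col_deg ms ?ns' N = 0" by (simp add: col_deg_def nth_append N_def)
  have exp_p: "col_exp (b + 1) ms ?ns' N = 0" for b :: real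
    unfolding col_exp_def deg_p by (simp add: N_def)
  have exp: "col_exp (b + 1) ms ?ns' (insert_index N j) = col_exp b ms ns j + 1" if "j < N" for b :: real and j
    unfolding col_exp_def deg[OF that] unfolding less[OF that] by auto
  have "wr_det (b + 1) ms ?ns' y = (-1) ^ N * (\<Prod>j<N. (if j < ?r then 1 else y) * u b j) * wr_det b ms ns y"
    for b y :: real
  proof (rule wr_det_remove_column[where d = 1])
    fix j g assume j: "j < N"
    show "(\<Sum>k\<le>col_deg ms ?ns' (insert_index N j). col_coeff (b + 1) ms ?ns' (insert_index N j) k *
         y ^ (col_deg ms ?ns' (insert_index N j) - k) *
         ((col_exp (b + 1) ms ?ns' (insert_index N j) - of_nat k - col_exp (b + 1) ms ?ns' N) * g k)) =
      (if j < ?r then 1 else y) * u b j *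
      (\<Sum>k\<le>col_deg ms ns j. col_coeff b ms ns j k * y ^ (col_deg ms ns j - k) * g k)"
    proof (cases "j < ?r")
      case True
      then show ?thesis
        using lag_column_shift_parameter[of "b + 1" "col_deg ms ns j" y g]
        unfolding exp[OF j] exp_p u_def col_coeff_def deg[OF j] unfolding less[OF j]
        by (simp add: col_exp_def algebra_simps)
    next
      case False
      have neg: "- (b + 1) = - b - 1" by simp
      from False show ?thesis
        using lag_column_Suc_degree[of "- b" "col_deg ms ns j" y g]
        unfolding exp[OF j] exp_p u_def col_coeff_def deg[OF j] unfolding less[OF j] neg
        by (simp add: col_exp_def algebra_simps)
    qed
  next
    show "col_deg ms ?ns' N = 0" by (rule deg_p)
  next
    fix j assume "j < N"
    then show "col_exp (b + 1) ms ?ns' (insert_index N j) = col_exp b ms ns j + 1" by (rule exp)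
  qed (simp_all add: N_def)
  moreover have "(\<Prod>j<N. (if j < ?r then 1 else y) * u b j) = y ^ ?s * (\<Prod>j<N. u b j)" for b y :: real
  proof -
    have "{..<N} \<inter> - {j. j < ?r} = {?r..<N}" by auto
    then show ?thesis by (simp add: prod.distrib prod.If_cases N_def)
  qed
  ultimately have wr: "wr_det (b + 1) ms ?ns' y = ((-1) ^ N * (\<Prod>j<N. u b j)) * y ^ ?s * wr_det b ms ns y"
    for b y :: real
    by (simp add: mult_ac)
  have V: "vandermonde_prod (Suc N) (col_exp (b + 1) ms ?ns') =
      ((-1) ^ N * (\<Prod>j<N. u b j)) * vandermonde_prod N (col_exp b ms ns)" for b :: real
    using vandermonde_remove_column[of N N "col_exp (b + 1) ms ?ns'" "col_exp b ms ns" 1] exp[of _ b] exp_p[of b]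
    by (simp add: u_def)
  show ?thesis
    by (rule PhiT_eval_shift[OF assms _ _ N_def _ _ _ wr V]) (use assms in \<open>auto simp: distinct_map tri_def N_def\<close>)
qed

section \<open>Shifted partitions and independence of r and s\<close>

lemma distinct_add_delta:
  assumes "is_partition lam"
  shows "distinct (add_delta lam r)"
proof -
  have "lam j + (r - 1 - j) < lam i + (r - 1 - i)" if "i < j" "j < r" for i j
  proof -
    have "lam j \<le> lam i" using assms that by (auto simp: is_partition_def)
    with that show ?thesis by linarith
  qed
  then show ?thesis
    unfolding add_delta_def distinct_map by (auto simp: inj_on_def) (metis nat_neq_iff)
qed

text \<open>If \<open>lam r\<close> were nonzero, so would be all \<open>r + 1\<close> parts up to
  it. Hence the new last entry is 0, and the longer staircase raises the others by one.\<close>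

lemma add_delta_Suc:
  assumes "is_partition lam" "part_length lam \<le> r"
  shows "add_delta lam (Suc r) = map Suc (add_delta lam r) @ [0]"
proof -
  have "lam r = 0"
  proof (rule ccontr)
    assume "lam r \<noteq> 0"
    moreover have "lam r \<le> lam i" if "i \<le> r" for i
      using assms(1) that by (simp add: is_partition_def)
    ultimately have "{..r} \<subseteq> {i. lam i \<noteq> 0}" by fastforce
    then have "card {..r} \<le> part_length lam"
      unfolding part_length_def using assms(1) by (intro card_mono) (auto simp: is_partition_def)
    with assms(2) show False by simp
  qed
  then show ?thesis by (simp add: add_delta_def Suc_diff_Suc)
qed

theorem theorem2p5:
  fixes lam mu :: "nat \<Rightarrow> nat" and r s r' s' :: nat
  assumes "is_partition lam" and "is_partition mu"
    and "part_length lam \<le> r" and "part_length mu \<le> s"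
    and "part_length lam \<le> r'" and "part_length mu \<le> s'"
  shows "\<forall>b y :: real.
    PhiT_eval (b - real r + real s) (add_delta lam r) (add_delta mu s) y =
    PhiT_eval (b - real r' + real s') (add_delta lam r') (add_delta mu s') y"
proof (intro allI)
  fix b y :: real
  define F where "F r s = PhiT_eval (b - real r + real s) (add_delta lam r) (add_delta mu s) y" for r s
  have step_r: "F (Suc r) s = F r s" if "part_length lam \<le> r" for r s
    using PhiT_eval_append_plus[of "add_delta lam r" "add_delta mu s" "b - real r + real s" y] assms that
    by (simp add: F_def distinct_add_delta add_delta_Suc algebra_simps)
  have step_s: "F r (Suc s) = F r s" if "part_length mu \<le> s" for r s
    using PhiT_eval_append_minus[of "add_delta lam r" "add_delta mu s" "b - real r + real s" y] assms that
    by (simp add: F_def distinct_add_delta add_delta_Suc algebra_simps)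
  \<comment> \<open>Both arguments descend to the lengths of the partitions, a common value for all
    admissible pairs.\<close>
  have "F r s = F (part_length lam) s" if "part_length lam \<le> r" for r s
    using that by (induction r rule: dec_induct) (auto simp: step_r)
  moreover have "F r s = F r (part_length mu)" if "part_length mu \<le> s" for r s
    using that by (induction s rule: dec_induct) (auto simp: step_s)
  ultimately show "F r s = F r' s'"
    using assms by metis
qed

end
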